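(* Let $q_1\in I^+(q_0)$ and let $(\psi,c,t_1)=\operatorname{Exp}^{-1}(q_1)$. Then the sub-Lorentzian length maximizers for the full problem \begin{align*} &\dot q=u_1X_1(q)+u_2X_2(q),\qquad q\in M,\\ &(u_1,u_2)\in U=\{(u_1,u_2)\in\mathbb R^2\mid u_1\ge|u_2|\},\\ &q(0)=q_0,\qquad q(T)=q_1,\\ &l(q(\cdot))=\int_0^{T}\sqrt{u_1^2-u_2^2}\,dt\to\max \end{align*} are reparametrizations of the corresponding length maximizer $q(t)=\operatorname{Exp}(\psi,c,t)$, $t\in[0,t_1]$, of the reduced sub-Lorentzian problem (the problem with $u_1>|u_2|$ in place of $u_1\ge |u_2|$). In particular, $d|_{I^+(q_0)}=\widetilde d$.
   Context: $M=\mathbb R^3_{x,y,z}$ is the Heisenberg group with product $(x_1,y_1,z_1)\cdot(x_2,y_2,z_2)=(x_1+x_2,\,y_1+y_2,\,z_1+z_2+(x_1y_2-x_2y_1)/2)$, $q_0=(0,0,0)$, $X_1=\frac{\partial}{\partial x}-\frac y2\frac{\partial}{\partial z}$, $X_2=\frac{\partial}{\partial y}+\frac x2\frac{\partial}{\partial z}$. Trajectories are Lipschitz curves satisfying the control system for a.e. $t$; the terminal time $T$ is free. A reparametrization of a curve $q(t)$, $t\in[0,t_1]$, is a curve $q(t(s))$, $s\in[0,s_1]$, with $t(\cdot)$ monotone nondecreasing Lipschitz from $[0,s_1]$ onto $[0,t_1]$; length is preserved by reparametrization. $I^+(q_0)$ is the chronological future of $q_0$ (points reachable from $q_0$ in positive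 time with $u_1>|u_2|$); it is known that $I^+(q_0)=\{(x,y,z)\mid -x^2+y^2+4|z|<0,\ x>0\}$. For $q_1\in I^+(q_0)$, $d(q_1)$ is the supremum of $l(q(\cdot))$ over all trajectories of the full problem connecting $q_0$ to $q_1$, and $\widetilde d(q_1)$ is the supremum of $l(q(\cdot))$ over all trajectories of the reduced problem (controls with $u_1>|u_2|$) connecting $q_0$ to $q_1$. The exponential mapping $\operatorname{Exp}:N\to I^+(q_0)$, $N=\mathbb R^2_{\psi,c}\times(0,+\infty)_t$, is $\operatorname{Exp}(\psi,c,t)=(x,y,z)$ with: if $c=0$, $x=t\cosh\psi$, $y=t\sinh\psi$, $z=0$; if $c\neq0$, $x=\frac{\sinh(\psi+ct)-\sinh\psi}{c}$, $y=\frac{\cosh(\psi+ct)-\cosh\psi}{c}$, $z=\frac{\sinh(ct)-ct}{2c^2}$. It is a diffeomorphism of $N$ onto $I^+(q_0)$; one sets $\operatorname{Exp}(\psi,c,0)=q_0$. *)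

theory Defs
  imports "HOL-Analysis.Analysis"
begin

type_synonym heis = "real \<times> real \<times> real"

definition q0 :: heis where
  "q0 = (0, 0, 0)"

definition X1 :: "heis \<Rightarrow> heis" where
  "X1 = (\<lambda>(x, y, z). (1, 0, - (y / 2)))"

definition X2 :: "heis \<Rightarrow> heis" where
  "X2 = (\<lambda>(x, y, z). (0, 1, x / 2))"

definition U_full :: "(real \<times> real) set" where
  "U_full = {(u1, u2). u1 \<ge> \<bar>u2\<bar>}"

definition U_red :: "(real \<times> real) set" where
  "U_red = {(u1, u2). u1 > \<bar>u2\<bar>}"

text \<open>
  Curves and controls are total functions on the reals, of which only the values on \<open>{0..T}\<close>
  matter.  Since \<open>X1\<close> and \<open>X2\<close> are linearly independent, the control is determined almost
  everywhere by the curve; it is essentially bounded because the curve is Lipschitz.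
\<close>

definition trajectory ::
  "(real \<times> real) set \<Rightarrow> heis \<Rightarrow> heis \<Rightarrow> real \<Rightarrow> (real \<Rightarrow> heis) \<Rightarrow> (real \<Rightarrow> real \<times> real) \<Rightarrow> bool"
where
  "trajectory U a b T q u \<longleftrightarrow>
     0 < T \<and> q 0 = a \<and> q T = b \<and>
     (\<exists>L. L-lipschitz_on {0..T} q) \<and>
     u \<in> borel_measurable (lebesgue_on {0..T}) \<and>
     (AE t in lebesgue_on {0..T}.
        u t \<in> U \<and>
        (q has_vector_derivative (fst (u t) *\<^sub>R X1 (q t) + snd (u t) *\<^sub>R X2 (q t)))
          (at t within {0..T}))"

definition sl_length :: "real \<Rightarrow> (real \<Rightarrow> real \<times> real) \<Rightarrow> real" where
  "sl_length T u = (LINT t|lebesgue_on {0..T}. sqrt ((fst (u t))\<^sup>2 - (snd (u t))\<^sup>2))"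

definition length_maximizer ::
  "(real \<times> real) set \<Rightarrow> heis \<Rightarrow> heis \<Rightarrow> real \<Rightarrow> (real \<Rightarrow> heis) \<Rightarrow> bool"
where
  "length_maximizer U a b T q \<longleftrightarrow>
     (\<exists>u. trajectory U a b T q u \<and>
          (\<forall>T' q' u'. trajectory U a b T' q' u' \<longrightarrow> sl_length T' u' \<le> sl_length T u))"

text \<open>The supremum is taken in the extended reals, so that it is meaningful without knowing
  beforehand that the lengths are bounded or that a trajectory exists.\<close>

definition max_length :: "(real \<times> real) set \<Rightarrow> heis \<Rightarrow> heis \<Rightarrow> ereal" where
  "max_length U a b = Sup {ereal (sl_length T u) | T q u. trajectory U a b T q u}"

definition d_full :: "heis \<Rightarrow> ereal" where
  "d_full = max_length U_full q0"

definition d_red :: "heis \<Rightarrow> ereal" where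
  "d_red = max_length U_red q0"

definition chronological_future :: "heis \<Rightarrow> heis set" where
  "chronological_future a = {b. \<exists>T q u. trajectory U_red a b T q u}"

definition exp_domain :: "(real \<times> real \<times> real) set" where
  "exp_domain = UNIV \<times> UNIV \<times> {0<..}"

text \<open>At \<open>t = 0\<close> both branches evaluate to \<open>q0\<close>.\<close>

definition sl_Exp :: "real \<times> real \<times> real \<Rightarrow> heis" where
  "sl_Exp = (\<lambda>(\<psi>, c, t).
     if c = 0 then (t * cosh \<psi>, t * sinh \<psi>, 0)
     else ((sinh (\<psi> + c * t) - sinh \<psi>) / c,
           (cosh (\<psi> + c * t) - cosh \<psi>) / c,
           (sinh (c * t) - c * t) / (2 * c\<^sup>2)))"

text \<open>\<open>p\<close> on \<open>{0..s1}\<close> is a reparametrization of \<open>q\<close> on \<open>{0..t1}\<close>.\<close>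

definition reparametrization ::
  "real \<Rightarrow> (real \<Rightarrow> heis) \<Rightarrow> real \<Rightarrow> (real \<Rightarrow> heis) \<Rightarrow> bool"
where
  "reparametrization s1 p t1 q \<longleftrightarrow>
     (\<exists>\<tau>. mono_on {0..s1} \<tau> \<and> (\<exists>L. L-lipschitz_on {0..s1} \<tau>) \<and>
          \<tau> ` {0..s1} = {0..t1} \<and> (\<forall>s\<in>{0..s1}. p s = q (\<tau> s)))"

end

theory Submission
  imports Defs "HOL-Real_Asymp.Real_Asymp"
begin

text \<open>
  In the coordinates \<open>v = x + y\<close>, \<open>w = x - y\<close> with controls \<open>a = u1 + u2 \<ge> 0\<close>, \<open>b = u1 - u2 \<ge> 0\<close>
  one has \<open>v' = a\<close>, \<open>w' = b\<close>, \<open>z' = (w a - v b) / 4\<close>, and the speed is \<open>sqrt (a b)\<close>.  Along the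
  geodesic of parameters \<open>(\<psi>, c)\<close> the hyperbolic angle \<open>\<psi> + c s\<close> satisfies
  \<open>exp (\<psi> + c s) = exp \<psi> + c v =: P\<close>, a function of \<open>v\<close> alone.  This singles out the calibration
  \<open>S = ln (1 + c v exp (- \<psi>)) / (2 c) + exp \<psi> w / 2 + c v w / 4 - c z\<close>, which is smooth on the
  relevant region, the light cone included.  Along any trajectory \<open>S' = (a / P + b P) / 2\<close>, and this
  is at least \<open>sqrt (a b)\<close> by the inequality of arithmetic and geometric means; hence every length
  is at most \<open>S q1 - S q0 = t1\<close>.  Equality forces \<open>b = a / P\<^sup>2\<close> almost everywhere, which means that
  the trajectory follows the geodesic with time change \<open>\<sigma>\<close> determined by \<open>v\<close>, \<open>\<sigma>' = a / P\<close>.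
  Conversely, a reparametrization is a trajectory because a monotone Lipschitz function is
  differentiable almost everywhere, which follows from the Vitali covering theorem.
\<close>

subsection \<open>Lipschitz functions on an interval\<close>

lemma AE_lebesgue_on_iff_negligible:
  assumes "S \<in> sets lebesgue"
  shows "(AE x in lebesgue_on S. P x) \<longleftrightarrow> (\<exists>N. negligible N \<and> (\<forall>x\<in>S - N. P x))"
proof -
  have "(AE x in lebesgue_on S. P x) \<longleftrightarrow> (AE x in lebesgue. x \<in> S \<longrightarrow> P x)"
    using assms by (simp add: AE_restrict_space_iff)
  also have "\<dots> \<longleftrightarrow> (\<exists>N. negligible N \<and> (\<forall>x\<in>S - N. P x))"
  proof
    assume "AE x in lebesgue. x \<in> S \<longrightarrow> P x"
    then obtain N where "N \<in> null_sets lebesgue" "{x \<in> space lebesgue. \<not> (x \<in> S \<longrightarrow> P x)} \<subseteq> N"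
      unfolding eventually_ae_filter by blast
    then show "\<exists>N. negligible N \<and> (\<forall>x\<in>S - N. P x)"
      by (intro exI[of _ N]) (auto simp: negligible_iff_null_sets)
  next
    assume "\<exists>N. negligible N \<and> (\<forall>x\<in>S - N. P x)"
    then obtain N where "N \<in> null_sets lebesgue" "\<forall>x\<in>S - N. P x"
      by (auto simp: negligible_iff_null_sets)
    then show "AE x in lebesgue. x \<in> S \<longrightarrow> P x"
      by (intro AE_I'[of N]) auto
  qed
  finally show ?thesis .
qed

text \<open>A direct gauge argument, assuming no integrability of \<open>f\<close>. On division
  intervals tagged outside \<open>N\<close> the derivative controls the increment of
  \<open>F\<close>. On those tagged in \<open>N\<close> the Lipschitz bound gives at most
  \<open>L\<close> times their total length, which is small because the indicator of
  \<open>N\<close> has integral 0.\<close>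

lemma lipschitz_fundamental_theorem:
  fixes F f :: "real \<Rightarrow> real"
  assumes "a \<le> b" and lip: "L-lipschitz_on {a..b} F" and N: "negligible N"
    and der: "\<And>x. x \<in> {a..b} - N \<Longrightarrow> (F has_vector_derivative f x) (at x within {a..b})"
  shows "(f has_integral (F b - F a)) {a..b}"
proof -
  define g where "g x = (if x \<in> N then 0 else f x)" for x
  have L: "0 \<le> L" using lip lipschitz_on_nonneg by blast
  have "(g has_integral (F b - F a)) {a..b}"
  proof (cases "a = b")
    case False
    with \<open>a \<le> b\<close> have ab: "a < b" by simp
    show ?thesis
      unfolding has_integral_factor_content_real
    proof (intro allI impI)
      fix e :: real assume "e > 0"
      \<comment> \<open>The error splits in halves: \<open>e1\<close> per unit length for tags
        outside \<open>N\<close>, and \<open>L * e2\<close> for all tags in \<open>N\<close>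
        together. Using \<open>L + 1\<close> in the denominator covers the case
        \<open>L = 0\<close>.\<close>
      define e1 where "e1 = e / 2"
      define e2 where "e2 = e * (b - a) / (2 * (L + 1))"
      have e1: "e1 > 0" and e2: "e2 > 0"
        using \<open>e > 0\<close> ab L by (auto simp: e1_def e2_def intro!: divide_pos_pos)
      have "\<forall>x. \<exists>d>0. x \<in> {a..b} - N \<longrightarrow>
         (\<forall>y\<in>{a..b}. norm (y-x) < d \<longrightarrow> norm (F y - F x - (y-x) *\<^sub>R f x) \<le> e1 * norm (y-x))"
        using der[unfolded has_vector_derivative_def has_derivative_within_alt] e1
        by metis
      then obtain d where d0: "\<And>x. 0 < d x"
        and d: "\<And>x y. \<lbrakk>x \<in> {a..b} - N; y \<in> {a..b}; norm (y-x) < d x\<rbrakk>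
                        \<Longrightarrow> norm (F y - F x - (y-x) *\<^sub>R f x) \<le> e1 * norm (y-x)"
        by metis
      have "(indicat_real N has_integral 0) (cbox a b)"
        using N unfolding negligible_def by blast
      then obtain \<gamma> where \<gamma>: "gauge \<gamma>"
        and fin: "\<And>p. p tagged_division_of (cbox a b) \<Longrightarrow> \<gamma> fine p \<Longrightarrow>
            norm ((\<Sum>(x,K)\<in>p. measure lborel K *\<^sub>R indicat_real N x) - 0) < e2"
        unfolding has_integral using e2 by meson
      show "\<exists>\<gamma>. gauge \<gamma> \<and> (\<forall>p. p tagged_division_of {a..b} \<and> \<gamma> fine p \<longrightarrow>
          norm ((\<Sum>(x, K)\<in>p. measure lborel K *\<^sub>R g x) - (F b - F a)) \<le> e * measure lborel {a..b})"
      proof (intro exI conjI allI impI)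
        show "gauge (\<lambda>x. \<gamma> x \<inter> ball x (d x))"
          using gauge_Int[OF \<gamma> gauge_ball_dependent] d0 by auto
        fix p assume "p tagged_division_of {a..b} \<and> (\<lambda>x. \<gamma> x \<inter> ball x (d x)) fine p"
        then have p: "p tagged_division_of {a..b}" and f1: "\<gamma> fine p" and f2: "(\<lambda>x. ball x (d x)) fine p"
          by (auto simp: fine_Int)
        have F: "F b - F a = (\<Sum>(x,K)\<in>p. F (Sup K) - F (Inf K))"
          and I: "b - a = (\<Sum>(x,K)\<in>p. Sup K - Inf K)"
          using additive_tagged_division_1[OF \<open>a \<le> b\<close> p, of F]
            additive_tagged_division_1[OF \<open>a \<le> b\<close> p, of "\<lambda>x. x"] by auto
        have "norm ((\<Sum>(x, K)\<in>p. measure lborel K *\<^sub>R g x) - (F b - F a))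
          = norm (\<Sum>(x, K)\<in>p. measure lborel K *\<^sub>R g x - (F (Sup K) - F (Inf K)))"
          unfolding F by (simp add: sum_subtractf split_def)
        also have "\<dots> \<le> (\<Sum>(x, K)\<in>p. e1 * (Sup K - Inf K) + L * (measure lborel K *\<^sub>R indicat_real N x))"
        proof (rule sum_norm_le, safe)
          fix x K assume xK: "(x, K) \<in> p"
          then obtain u v where K: "K = cbox u v" and xin: "x \<in> K" and sub: "K \<subseteq> {a..b}"
            using p by (metis tagged_division_ofD(2-4))
          have uv: "u \<le> v" "u \<le> x" "x \<le> v" "x \<in> {a..b}" "u \<in> {a..b}" "v \<in> {a..b}"
            using xin sub K by auto
          have SI: "Sup K = v" "Inf K = u" "measure lborel K = v - u"
            using uv K by (auto simp: )
          show "norm (measure lborel K *\<^sub>R g x - (F (Sup K) - F (Inf K)))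
              \<le> e1 * (Sup K - Inf K) + L * (measure lborel K *\<^sub>R indicat_real N x)"
          proof (cases "x \<in> N")
            case True
            have "\<bar>F v - F u\<bar> \<le> L * (v - u)"
              using lipschitz_onD[OF lip, of v u] uv by (simp add: dist_real_def)
            moreover have "0 \<le> e1 * (v - u)" using e1 uv by simp
            ultimately show ?thesis using True by (simp add: SI g_def)
          next
            case False
            have "K \<subseteq> ball x (d x)" using f2 xK by (auto simp: fine_def)
            moreover have "u \<in> K" "v \<in> K" using K uv by auto
            ultimately have "u \<in> ball x (d x)" "v \<in> ball x (d x)" by blast+
            then have "norm (u - x) < d x" "norm (v - x) < d x"
              by (auto simp: dist_real_def abs_minus_commute)
            then have "\<bar>F u - F x - (u-x) * f x\<bar> \<le> e1 * (x - u)"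
              "\<bar>F v - F x - (v-x) * f x\<bar> \<le> e1 * (v - x)"
              using d[of x u] d[of x v] uv False by auto
            \<comment> \<open>The tag lies between \<open>u\<close> and \<open>v\<close>, so the
              errors \<open>e1 * (x - u)\<close> and \<open>e1 * (v - x)\<close> on its two sides
              add up to exactly \<open>e1 * (v - u)\<close>.\<close>
            then have "\<bar>(v - u) * f x - (F v - F u)\<bar> \<le> e1 * (v - u)"
              by (auto simp: algebra_simps abs_le_iff)
            then show ?thesis using False by (simp add: SI g_def)
          qed
        qed
        also have "\<dots> = e1 * (b - a) + L * (\<Sum>(x,K)\<in>p. measure lborel K *\<^sub>R indicat_real N x)"
          unfolding I by (simp add: sum.distrib sum_distrib_left split_def)
        also have "\<dots> \<le> e1 * (b - a) + L * e2"
          using fin[of p] p f1 L by (intro add_left_mono mult_left_mono) auto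
        also have "\<dots> \<le> e1 * (b - a) + (L + 1) * e2"
          using e2 by (simp add: algebra_simps)
        also have "\<dots> = e * (b - a)"
        proof -
          have "(L + 1) * e2 = e * (b - a) / 2" using L by (simp add: e2_def divide_simps) (simp add: algebra_simps)
          then show ?thesis by (simp add: e1_def)
        qed
        also have "\<dots> = e * measure lborel {a..b}" using ab by simp
        finally show "norm ((\<Sum>(x, K)\<in>p. measure lborel K *\<^sub>R g x) - (F b - F a)) \<le> e * measure lborel {a..b}" .
      qed
    qed
  qed auto
  then show ?thesis
    by (rule has_integral_spike[OF N, rotated]) (auto simp: g_def)
qed

lemma lipschitz_fundamental_theorem_AE:
  fixes F f :: "real \<Rightarrow> real"
  assumes "a \<le> b" and lip: "L-lipschitz_on {a..b} F"
    and der: "AE x in lebesgue_on {a..b}. (F has_vector_derivative f x) (at x within {a..b})"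
  shows "(f has_integral (F b - F a)) {a..b}"
  using assms lipschitz_fundamental_theorem by (auto simp: AE_lebesgue_on_iff_negligible)

lemma lipschitz_nonneg_derivative_imp_le:
  fixes F f :: "real \<Rightarrow> real"
  assumes "a \<le> b" and lip: "L-lipschitz_on {a..b} F"
    and der: "AE x in lebesgue_on {a..b}. (F has_vector_derivative f x) (at x within {a..b}) \<and> 0 \<le> f x"
  shows "F a \<le> F b"
proof -
  from der obtain N where N: "negligible N"
    and D: "\<And>x. x \<in> {a..b} - N \<Longrightarrow> (F has_vector_derivative f x) (at x within {a..b}) \<and> 0 \<le> f x"
    by (subst (asm) AE_lebesgue_on_iff_negligible) auto
  have "(f has_integral (F b - F a)) {a..b}"
    using lipschitz_fundamental_theorem[OF assms(1) lip N] D by blast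
  then have "((\<lambda>x. if x \<in> N then 0 else f x) has_integral (F b - F a)) {a..b}"
    by (rule has_integral_spike[OF N, rotated]) auto
  then have "0 \<le> F b - F a"
    by (rule has_integral_nonneg) (use D in auto)
  then show ?thesis by simp
qed

lemma AE_lebesgue_on_subset:
  assumes "AE x in lebesgue_on S. P x" "S \<in> sets lebesgue" "T \<in> sets lebesgue" "T \<subseteq> S"
  shows "AE x in lebesgue_on T. P x"
  using assms by (auto simp: AE_lebesgue_on_iff_negligible)

lemma continuous_vector_derivative_imp_lipschitz:
  fixes f :: "real \<Rightarrow> 'a::real_normed_vector"
  assumes der: "\<And>x. x \<in> {a..b} \<Longrightarrow> (f has_vector_derivative f' x) (at x within {a..b})"
    and cont: "continuous_on {a..b} f'"
  shows "\<exists>L. L-lipschitz_on {a..b} f"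
proof -
  have "bounded (f' ` {a..b})"
    using cont by (intro compact_imp_bounded compact_continuous_image) auto
  then obtain B where B: "B > 0" "\<And>x. x \<in> {a..b} \<Longrightarrow> norm (f' x) \<le> B"
    unfolding bounded_pos by auto
  have "B-lipschitz_on {a..b} f"
  proof (rule bounded_derivative_imp_lipschitz)
    show "(f has_derivative (\<lambda>h. h *\<^sub>R f' x)) (at x within {a..b})" if "x \<in> {a..b}" for x
      using der[OF that] by (simp add: has_vector_derivative_def)
    show "onorm (\<lambda>h. h *\<^sub>R f' x) \<le> B" if "x \<in> {a..b}" for x
      using B(2)[OF that] by (intro onorm_le) (simp add: mult.commute[of B] mult_left_mono)
  qed (use B in auto)
  then show ?thesis by blast
qed

lemma lipschitz_on_mult_real:
  fixes f g :: "real \<Rightarrow> real"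
  assumes f: "\<exists>L. L-lipschitz_on {a..b} f" and g: "\<exists>L. L-lipschitz_on {a..b} g"
  shows "\<exists>L. L-lipschitz_on {a..b} (\<lambda>x. f x * g x)"
proof -
  obtain L M where L: "L-lipschitz_on {a..b} f" and M: "M-lipschitz_on {a..b} g" using f g by blast
  have "bounded (f ` {a..b})" "bounded (g ` {a..b})"
    using L M lipschitz_on_continuous_on by (auto intro!: compact_imp_bounded compact_continuous_image)
  then obtain A B where A: "A > 0" "\<And>x. x \<in> {a..b} \<Longrightarrow> \<bar>f x\<bar> \<le> A"
    and B: "B > 0" "\<And>x. x \<in> {a..b} \<Longrightarrow> \<bar>g x\<bar> \<le> B"
    unfolding bounded_pos by (metis image_eqI real_norm_def)
  have nn: "0 \<le> L" "0 \<le> M" using L M lipschitz_on_nonneg by blast+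
  have "(A * M + B * L)-lipschitz_on {a..b} (\<lambda>x. f x * g x)"
  proof (rule lipschitz_onI)
    fix x y assume xy: "x \<in> {a..b}" "y \<in> {a..b}"
    have "f x * g x - f y * g y = f x * (g x - g y) + g y * (f x - f y)"
      by (simp add: algebra_simps)
    then have "dist (f x * g x) (f y * g y) \<le> \<bar>f x\<bar> * dist (g x) (g y) + \<bar>g y\<bar> * dist (f x) (f y)"
      by (simp add: dist_real_def abs_mult[symmetric] abs_triangle_ineq)
    also have "\<dots> \<le> A * (M * dist x y) + B * (L * dist x y)"
      using A B xy lipschitz_onD[OF L xy] lipschitz_onD[OF M xy]
      by (intro add_mono mult_mono) auto
    finally show "dist (f x * g x) (f y * g y) \<le> (A * M + B * L) * dist x y"
      by (simp add: algebra_simps)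
  qed (use A B nn in auto)
  then show ?thesis by blast
qed

lemma lipschitz_on_add_cmult:
  fixes f g :: "'a::metric_space \<Rightarrow> real"
  assumes "\<exists>L. L-lipschitz_on S f" "\<exists>L. L-lipschitz_on S g"
  shows "\<exists>L. L-lipschitz_on S (\<lambda>x. f x + k * g x)"
  using assms lipschitz_on_add lipschitz_on_cmult_real by blast

lemma lipschitz_zero_derivative_imp_eq:
  fixes F :: "real \<Rightarrow> real"
  assumes lip: "L-lipschitz_on {a..b} F" and x: "x \<in> {a..b}"
    and der: "AE t in lebesgue_on {a..b}. (F has_vector_derivative 0) (at t within {a..b})"
  shows "F x = F a"
proof -
  have "AE t in lebesgue_on {a..x}. (F has_vector_derivative 0) (at t within {a..b})"
    using x by (intro AE_lebesgue_on_subset[OF der]) auto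
  then have "AE t in lebesgue_on {a..x}. (F has_vector_derivative 0) (at t within {a..x})"
    using x by (auto elim!: eventually_mono intro: has_vector_derivative_within_subset)
  then have "((\<lambda>_. 0) has_integral (F x - F a)) {a..x}"
    using x by (intro lipschitz_fundamental_theorem_AE[OF _ lipschitz_on_subset[OF lip]]) auto
  then show ?thesis using has_integral_unique has_integral_0 by fastforce
qed

text \<open>A bridge from the gauge integral, which the fundamental theorem delivers, to the
  Lebesgue integral, in which length is defined. Nonnegative gauge integrable functions are
  absolutely integrable, and truncating \<open>D\<close> at 0 makes nonnegativity hold everywhere at
  the cost of a null set.\<close>

lemma has_integral_AE_nonneg:
  fixes D :: "real \<Rightarrow> real"
  assumes I: "(D has_integral I) {a..b}" and nn: "AE t in lebesgue_on {a..b}. 0 \<le> D t"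
  obtains f where "integrable (lebesgue_on {a..b}) f" "AE t in lebesgue_on {a..b}. f t = D t"
    "\<And>t. 0 \<le> f t" "integral\<^sup>L (lebesgue_on {a..b}) f = I"
proof
  let ?f = "\<lambda>t. max 0 (D t)"
  from nn obtain N where N: "negligible N" "\<And>t. t \<in> {a..b} - N \<Longrightarrow> 0 \<le> D t"
    by (auto simp: AE_lebesgue_on_iff_negligible)
  have hi: "(?f has_integral I) {a..b}"
    using has_integral_spike[OF N(1) _ I] N(2) by (metis max.absorb2)
  then have "?f absolutely_integrable_on {a..b}"
    by (intro nonnegative_absolutely_integrable_1) (auto simp: has_integral_integrable)
  then show int: "integrable (lebesgue_on {a..b}) ?f"
    by (intro absolutely_integrable_imp_integrable) auto
  show "AE t in lebesgue_on {a..b}. ?f t = D t" using nn by eventually_elim simp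
  show "integral\<^sup>L (lebesgue_on {a..b}) ?f = I"
    using lebesgue_integral_eq_integral[OF int] hi by (simp add: integral_unique)
qed simp

lemma not_AE_False_lebesgue_on:
  assumes "a < (b::real)"
  shows "\<not> (AE t in lebesgue_on {a..b}. False)"
proof
  assume "AE t in lebesgue_on {a..b}. False"
  then have "\<exists>N. negligible N \<and> (\<forall>t\<in>{a..b} - N. False)"
    by (subst (asm) AE_lebesgue_on_iff_negligible) auto
  then obtain N where "negligible N" "{a..b} \<subseteq> N" by blast
  then have "negligible {a..b}" using negligible_subset by blast
  then show False using negligible_interval(1)[of a b] assms by auto
qed

text \<open>If the increment were 0, the nonnegative derivative would have zero integral and hence
  vanish almost everywhere, against \<open>pos\<close> on an interval of positive length.\<close>

lemma lipschitz_pos_derivative_imp_less: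
  fixes F f :: "real \<Rightarrow> real"
  assumes "a < b" and lip: "L-lipschitz_on {a..b} F"
    and der: "AE x in lebesgue_on {a..b}. (F has_vector_derivative f x) (at x within {a..b})"
    and pos: "AE x in lebesgue_on {a..b}. 0 < f x"
  shows "F a < F b"
proof -
  have I: "(f has_integral (F b - F a)) {a..b}"
    using lipschitz_fundamental_theorem_AE[OF _ lip der] \<open>a < b\<close> by simp
  obtain g where g: "integrable (lebesgue_on {a..b}) g" "AE t in lebesgue_on {a..b}. g t = f t"
    "\<And>t. 0 \<le> g t" "integral\<^sup>L (lebesgue_on {a..b}) g = F b - F a"
    by (rule has_integral_AE_nonneg[OF I]) (use pos in \<open>auto elim!: eventually_mono\<close>)
  have "F b - F a \<noteq> 0"
  proof
    assume "F b - F a = 0"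
    then have "AE t in lebesgue_on {a..b}. g t = 0"
      using integral_nonneg_eq_0_iff_AE[OF g(1)] g(3,4) by simp
    with g(2) pos have "AE t in lebesgue_on {a..b}. False" by eventually_elim simp
    then show False using not_AE_False_lebesgue_on[OF \<open>a < b\<close>] by blast
  qed
  moreover have "0 \<le> F b - F a" using g(3,4) by (metis integral_nonneg_AE AE_I2)
  ultimately show ?thesis by simp
qed


subsection \<open>Differentiability of monotone Lipschitz functions\<close>

text \<open>An open interval is a ball about its midpoint. The covering theorem asks only that
  \<open>x\<close> lie in the ball, not that it be the centre, so intervals placed off-centre around
  \<open>x\<close> are allowed.\<close>

lemma Vitali_covering_intervals:
  fixes S :: "real set"
  assumes cov: "\<And>x d. x \<in> S \<Longrightarrow> 0 < d \<Longrightarrow> \<exists>s t. (s, t) \<in> K \<and> s < x \<and> x < t \<and> t - s < d"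
  obtains C where "countable C" "C \<subseteq> K" "disjoint_family_on (\<lambda>i. {fst i<..<snd i}) C"
    "negligible (S - (\<Union>i\<in>C. {fst i<..<snd i}))"
proof -
  define a r where "a i = (fst i + snd i) / 2" and "r i = (snd i - fst i) / 2" for i :: "real \<times> real"
  have ball: "ball (a i) (r i) = {fst i<..<snd i}" for i
    by (simp add: ball_eq_greaterThanLessThan a_def r_def field_simps)
  show thesis
  proof (rule Vitali_covering_theorem_balls[of S K a r])
    fix x d :: real assume "x \<in> S" "0 < d"
    then obtain s t where "(s, t) \<in> K" "s < x" "x < t" "t - s < d" using cov by blast
    then show "\<exists>i. i \<in> K \<and> x \<in> ball (a i) (r i) \<and> r i < d"
      unfolding ball by (intro exI[of _ "(s, t)"]) (auto simp: r_def)
  next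
    fix C assume C: "countable C" "C \<subseteq> K" "negligible (S - (\<Union>i\<in>C. ball (a i) (r i)))"
      "pairwise (\<lambda>i j. disjnt (ball (a i) (r i)) (ball (a j) (r j))) C"
    have "disjoint_family_on (\<lambda>i. {fst i<..<snd i}) C"
      using C(4) unfolding ball disjoint_family_on_def pairwise_def disjnt_def by blast
    then show thesis using that C unfolding ball by blast
  qed
qed

text \<open>Continuity of \<open>F\<close> rules out atoms, so the two endpoints of the closed
  interval have measure zero.\<close>

lemma emeasure_interval_measure_Ioo:
  fixes F :: "real \<Rightarrow> real"
  assumes F: "mono F" "continuous_on UNIV F" and "a < b"
  shows "emeasure (interval_measure F) {a<..<b} = F b - F a"
proof -
  have Icc: "emeasure (interval_measure F) {x..y} = F y - F x" if "x \<le> y" for x y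
    using F that by (intro emeasure_interval_measure_Icc) (auto simp: mono_def)
  have "{a} \<union> {b} \<in> null_sets (interval_measure F)"
    using Icc[of a a] Icc[of b b] by (intro null_sets.Un) (auto simp: null_sets_def)
  then have "emeasure (interval_measure F) {a<..<b} = emeasure (interval_measure F) ({a<..<b} \<union> ({a} \<union> {b}))"
    by (intro emeasure_Un_null_set[symmetric]) auto
  also have "{a<..<b} \<union> ({a} \<union> {b}) = {a..b}" using \<open>a < b\<close> by auto
  finally show ?thesis using Icc[of a b] \<open>a < b\<close> by simp
qed

text \<open>Slopes are taken over intervals with \<open>x\<close> strictly inside, rather than over
  intervals ending at \<open>x\<close>. Such intervals are open sets around \<open>x\<close>, which
  makes the set Borel and gives the Vitali coverings directly.\<close>

definition slope_gap_set :: "(real \<Rightarrow> real) \<Rightarrow> real \<Rightarrow> real \<Rightarrow> real set" where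
  "slope_gap_set F p q =
    {x. (\<forall>d>0. \<exists>s t. s < x \<and> x < t \<and> t - s < d \<and> F t - F s < p * (t - s)) \<and>
        (\<forall>d>0. \<exists>s t. s < x \<and> x < t \<and> t - s < d \<and> F t - F s > q * (t - s))}"

text \<open>For each bound \<open>1 / real (Suc n)\<close> on the length, the points inside some
  admissible interval form a union of open intervals. The set is therefore a countable intersection
  of open sets, whatever \<open>P\<close> is.\<close>

lemma borel_small_intervals:
  "{x::real. \<forall>d>0. \<exists>s t. s < x \<and> x < t \<and> t - s < d \<and> P s t} \<in> sets borel"
proof -
  have "{x::real. \<forall>d>0. \<exists>s t. s < x \<and> x < t \<and> t - s < d \<and> P s t}
      = (\<Inter>n. \<Union>{{s<..<t} | s t. t - s < 1 / real (Suc n) \<and> P s t})" (is "?A = ?B")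
  proof
    show "?A \<subseteq> ?B"
    proof
      fix x assume x: "x \<in> ?A"
      have "\<exists>s t. s < x \<and> x < t \<and> t - s < 1 / real (Suc n) \<and> P s t" for n
        using x by (simp del: of_nat_Suc)
      then have "x \<in> \<Union>{{s<..<t} | s t. t - s < 1 / real (Suc n) \<and> P s t}" for n
      proof -
        obtain s t where "s < x" "x < t" "t - s < 1 / real (Suc n)" "P s t"
          using \<open>\<And>n. \<exists>s t. s < x \<and> x < t \<and> t - s < 1 / real (Suc n) \<and> P s t\<close> by blast
        then show ?thesis by (intro UnionI[of "{s<..<t}"]) (blast, simp)
      qed
      then show "x \<in> ?B" by blast
    qed
    show "?B \<subseteq> ?A"
    proof
      fix x assume x: "x \<in> ?B"
      have "\<exists>s t. s < x \<and> x < t \<and> t - s < d \<and> P s t" if "d > 0" for d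
      proof -
        obtain n where "1 / real (Suc n) < d" using nat_approx_posE[OF \<open>d > 0\<close>] .
        moreover have "x \<in> \<Union>{{s<..<t} | s t. t - s < 1 / real (Suc n) \<and> P s t}"
          using x by blast
        then obtain s t where "s < x" "x < t" "t - s < 1 / real (Suc n)" "P s t"
          by (auto simp del: of_nat_Suc)
        ultimately show ?thesis by (meson less_trans)
      qed
      then show "x \<in> ?A" by simp
    qed
  qed
  also have "?B \<in> sets borel"
  proof (intro sets.countable_INT'')
    show "\<Union>{{s<..<t} | s t. t - s < 1 / real (Suc n) \<and> P s t} \<in> sets borel" for n
      by (intro borel_open open_Union) auto
  qed (auto intro: countableI_type)
  finally show ?thesis .
qed

text \<open>Cover the set up to a null set by disjoint intervals of slope below \<open>p\<close>, then within these by
  disjoint intervals of slope above \<open>q\<close>, and compare Lebesgue measure with \<open>interval_measure F\<close>.\<close>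

lemma negligible_slope_gap_set:
  fixes F :: "real \<Rightarrow> real"
  assumes F: "mono F" "continuous_on UNIV F" and "p < q"
  shows "negligible (slope_gap_set F p q)"
proof (subst negligible_on_intervals, intro allI)
  fix a b :: real
  define G where "G = slope_gap_set F p q \<inter> cbox a b"
  define m where "m = measure lebesgue G"
  define I where "I = (\<lambda>i :: real \<times> real. {fst i<..<snd i})"
  have small: "\<exists>s t. s < x \<and> x < t \<and> t - s < d \<and> F t - F s < p * (t - s)"
    and steep: "\<exists>s t. s < x \<and> x < t \<and> t - s < d \<and> F t - F s > q * (t - s)"
    if "x \<in> G" "d > 0" for x d
    using that unfolding G_def slope_gap_set_def by blast+
  have "slope_gap_set F p q \<in> sets borel"
    unfolding slope_gap_set_def Collect_conj_eq by (intro sets.Int borel_small_intervals)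
  then have "G \<in> sets borel" unfolding G_def by auto
  then have G: "G \<in> lmeasurable" "G \<in> sets lebesgue" "G \<in> sets lborel"
    using bounded_set_imp_lmeasurable[of G] by (auto simp: G_def bounded_Int)
  show "negligible (slope_gap_set F p q \<inter> cbox a b)"
  proof (cases "G = {}")
    case False
    then obtain x where "x \<in> G" by auto
    then obtain s t where "s < x" "x < t" and st: "F t - F s < p * (t - s)"
      using small[of x 1] by auto
    then have "s < t" by simp
    then have "F s \<le> F t" using F(1) by (auto simp: mono_def)
    \<comment> \<open>A monotone function has nonnegative slopes, so a single slope below
      \<open>p\<close> at a point of \<open>G\<close> already makes \<open>p\<close> positive. This
      allows the later passage to \<open>ennreal\<close>.\<close>
    with st have "0 < p * (t - s)" by simp
    then have p: "p > 0" using \<open>s < t\<close> by (simp add: zero_less_mult_iff)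
    then have q: "q > 0" using \<open>p < q\<close> by simp
    have Ib: "I i \<in> sets borel" for i by (simp add: I_def)
    have sum: "emeasure M (\<Union>i\<in>C. I i) = (\<integral>\<^sup>+ i. emeasure M (I i) \<partial>count_space C)"
      if "countable C" "disjoint_family_on I C" "sets M = sets borel" for C M
      using that Ib by (intro emeasure_UN_countable) auto
    \<comment> \<open>With \<open>O'\<close> open around \<open>G\<close> and of measure below
      \<open>m + e\<close>, and \<open>O2\<close> inside \<open>O1\<close> inside \<open>O'\<close>
      the unions of the steep and the flat intervals, the chain is \<open>q * m\<close> at most
      \<open>q\<close> times the length of \<open>O2\<close>, at most the \<open>F\<close>-measure
      of \<open>O2\<close>, at most that of \<open>O1\<close>, at most \<open>p\<close> times the
      length of \<open>O1\<close>, at most \<open>p * (m + e)\<close>.\<close>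
    have key: "q * m \<le> p * (m + e)" if "e > 0" for e
    proof -
      obtain O' where O': "open O'" "G \<subseteq> O'" and diff: "O' - G \<in> lmeasurable"
        "emeasure lebesgue (O' - G) < ennreal e"
        using sets_lebesgue_outer_open[OF G(2) \<open>e > 0\<close>] by metis
      have O'_eq: "O' = G \<union> (O' - G)" using O'(2) by auto
      have O'_meas: "O' \<in> lmeasurable"
        by (subst O'_eq) (intro fmeasurable.Un G diff)
      have "measure lebesgue (O' - G) < e"
        using diff(2) \<open>e > 0\<close> by (simp add: emeasure_eq_measure2[OF diff(1)] ennreal_less_iff)
      moreover have "measure lebesgue O' \<le> measure lebesgue G + measure lebesgue (O' - G)"
        by (subst O'_eq) (intro measure_Un_le G fmeasurableD diff)
      ultimately have O'_less: "measure lebesgue O' < m + e" by (simp add: m_def)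
      define K1 where "K1 = {(s, t). s < t \<and> {s<..<t} \<subseteq> O' \<and> F t - F s < p * (t - s)}"
      obtain C1 where C1: "countable C1" "C1 \<subseteq> K1" "disjoint_family_on I C1"
        "negligible (G - (\<Union>i\<in>C1. I i))"
      proof (rule Vitali_covering_intervals[of G K1])
        fix x d :: real assume xd: "x \<in> G" "0 < d"
        then obtain r where r: "r > 0" "ball x r \<subseteq> O'"
          using O'(1,2) open_contains_ball by blast
        obtain s t where st: "s < x" "x < t" "t - s < min d r" "F t - F s < p * (t - s)"
          using small[of x "min d r"] xd r by auto
        then have "{s<..<t} \<subseteq> ball x r" by (auto simp: dist_real_def)
        then show "\<exists>s t. (s, t) \<in> K1 \<and> s < x \<and> x < t \<and> t - s < d"
          using st r unfolding K1_def by (intro exI[of _ s] exI[of _ t]) auto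
      qed (auto simp: I_def)
      define O1 where "O1 = (\<Union>i\<in>C1. I i)"
      define K2 where "K2 = {(s, t). s < t \<and> {s<..<t} \<subseteq> O1 \<and> F t - F s > q * (t - s)}"
      have "open O1" unfolding O1_def I_def by auto
      obtain C2 where C2: "countable C2" "C2 \<subseteq> K2" "disjoint_family_on I C2"
        "negligible (G \<inter> O1 - (\<Union>i\<in>C2. I i))"
      proof (rule Vitali_covering_intervals[of "G \<inter> O1" K2])
        fix x d :: real assume xd: "x \<in> G \<inter> O1" "0 < d"
        then obtain r where r: "r > 0" "ball x r \<subseteq> O1"
          using \<open>open O1\<close> open_contains_ball by blast
        obtain s t where st: "s < x" "x < t" "t - s < min d r" "F t - F s > q * (t - s)"
          using steep[of x "min d r"] xd r by auto
        then have "{s<..<t} \<subseteq> ball x r" by (auto simp: dist_real_def)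
        then show "\<exists>s t. (s, t) \<in> K2 \<and> s < x \<and> x < t \<and> t - s < d"
          using st r unfolding K2_def by (intro exI[of _ s] exI[of _ t]) auto
      qed (auto simp: I_def)
      define O2 where "O2 = (\<Union>i\<in>C2. I i)"
      have "open O2" unfolding O2_def I_def by auto
      have sub: "O2 \<subseteq> O1" "O1 \<subseteq> O'"
        using C1(2) C2(2) unfolding O1_def O2_def K1_def K2_def I_def by (auto simp: subset_iff split_beta)
      have bor: "O1 \<in> sets borel" "O2 \<in> sets borel" "O' \<in> sets borel"
        using \<open>open O1\<close> O'(1) \<open>open O2\<close> by auto
      let ?\<nu> = "interval_measure F"
      \<comment> \<open>A point of \<open>G\<close> missed by \<open>O2\<close> is missed by the
        first covering, or lies in \<open>O1\<close> and is missed by the second.\<close>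
      have "negligible (G - O2)"
        using C1(4) C2(4) unfolding O1_def[symmetric] O2_def[symmetric]
        by (rule negligible_subset[OF negligible_Un]) auto
      then have null: "G - O2 \<in> null_sets lborel"
        using G(3) bor(2) by (simp add: negligible_iff_null_sets null_sets_completion_iff)
      then have "emeasure lborel G \<le> emeasure lborel O2"
        using bor(2) by (intro emeasure_mono_AE AE_I'[OF null]) auto
      then have "ennreal q * emeasure lborel G \<le> ennreal q * emeasure lborel O2"
        by (intro mult_left_mono) auto
      also have "\<dots> = (\<integral>\<^sup>+ i. ennreal q * emeasure lborel (I i) \<partial>count_space C2)"
        unfolding O2_def using C2 by (subst sum) (auto simp: nn_integral_cmult)
      also have "\<dots> \<le> (\<integral>\<^sup>+ i. emeasure ?\<nu> (I i) \<partial>count_space C2)"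
      proof (intro nn_integral_mono)
        fix i assume "i \<in> space (count_space C2)"
        then obtain s t where i: "i = (s, t)" "s < t" "F t - F s > q * (t - s)"
          using C2(2) unfolding K2_def by auto
        then show "ennreal q * emeasure lborel (I i) \<le> emeasure ?\<nu> (I i)"
          using q by (simp add: I_def emeasure_interval_measure_Ioo[OF F] ennreal_mult[symmetric] ennreal_leI)
      qed
      also have "\<dots> = emeasure ?\<nu> O2"
        unfolding O2_def using C2 by (subst sum) auto
      also have "\<dots> \<le> emeasure ?\<nu> O1"
        using sub bor by (intro emeasure_mono) auto
      also have "\<dots> = (\<integral>\<^sup>+ i. emeasure ?\<nu> (I i) \<partial>count_space C1)"
        unfolding O1_def using C1 by (subst sum) auto
      also have "\<dots> \<le> (\<integral>\<^sup>+ i. ennreal p * emeasure lborel (I i) \<partial>count_space C1)"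
      proof (intro nn_integral_mono)
        fix i assume "i \<in> space (count_space C1)"
        then obtain s t where i: "i = (s, t)" "s < t" "F t - F s < p * (t - s)"
          using C1(2) unfolding K1_def by auto
        then show "emeasure ?\<nu> (I i) \<le> ennreal p * emeasure lborel (I i)"
          using p by (simp add: I_def emeasure_interval_measure_Ioo[OF F] ennreal_mult[symmetric] ennreal_leI)
      qed
      also have "\<dots> = ennreal p * emeasure lborel O1"
        unfolding O1_def using C1 by (subst sum) (auto simp: nn_integral_cmult)
      also have "\<dots> \<le> ennreal p * emeasure lborel O'"
        using sub bor by (intro mult_left_mono emeasure_mono) auto
      also have "emeasure lborel O' = ennreal (measure lebesgue O')"
        using emeasure_eq_measure2[OF O'_meas] bor(3) by simp
      also have "emeasure lborel G = ennreal m"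
        using emeasure_eq_measure2[OF G(1)] G(3) by (simp add: m_def)
      finally have "ennreal (q * m) \<le> ennreal (p * measure lebesgue O')"
        using p q by (simp add: ennreal_mult m_def)
      then have "q * m \<le> p * measure lebesgue O'"
        using p by (subst (asm) ennreal_le_iff) auto
      also have "\<dots> \<le> p * (m + e)" using p O'_less by simp
      finally show ?thesis .
    qed
    have "q * m \<le> p * m"
    proof (rule field_le_epsilon)
      fix e :: real assume "e > 0"
      then have "q * m \<le> p * (m + e / p)" using p by (intro key) simp
      then show "q * m \<le> p * m + e" using p by (simp add: distrib_left)
    qed
    moreover have "m \<ge> 0" by (simp add: m_def)
    ultimately have "m = 0" using \<open>p < q\<close> by (metis mult_right_le_imp_le not_le less_eq_real_def)
    then show ?thesis
      using G(1) unfolding m_def G_def by (metis negligible_iff_measure0)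
  qed (simp add: G_def)
qed

text \<open>The limit is the infimum of the rational eventual upper bounds: by the dichotomy, every
  rational below a rational that is not such a bound is an eventual lower bound. Only rational pairs
  occur, so that in the application the exceptional set is a countable union.\<close>

lemma tendsto_real_of_rational_dichotomy:
  fixes Q :: "'a \<Rightarrow> real"
  assumes bdd: "eventually (\<lambda>x. \<bar>Q x\<bar> \<le> L) F" and "F \<noteq> bot"
    and dich: "\<And>p q. \<lbrakk>p \<in> \<rat>; q \<in> \<rat>; p < q\<rbrakk> \<Longrightarrow>
        eventually (\<lambda>x. Q x \<le> q) F \<or> eventually (\<lambda>x. p \<le> Q x) F"
  shows "\<exists>l. (Q \<longlongrightarrow> l) F"
proof -
  define A where "A = {q \<in> \<rat>. eventually (\<lambda>x. Q x \<le> q) F}"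
  obtain q0 where "q0 \<in> \<rat>" "L < q0" using Rats_dense_in_real[of L "L + 1"] by auto
  then have "q0 \<in> A" using bdd by (auto simp: A_def elim: eventually_mono)
  have low: "- L \<le> q" if "q \<in> A" for q
  proof -
    have "eventually (\<lambda>x. - L \<le> q) F"
      using that bdd unfolding A_def by (auto elim: eventually_elim2)
    then show ?thesis using \<open>F \<noteq> bot\<close> by (simp add: eventually_const)
  qed
  then have bb: "bdd_below A" by (rule bdd_belowI)
  have "(Q \<longlongrightarrow> Inf A) F"
  proof (rule order_tendstoI)
    fix a assume "a < Inf A"
    then obtain q where q: "q \<in> \<rat>" "a < q" "q < Inf A" using Rats_dense_in_real by blast
    obtain p where p: "p \<in> \<rat>" "a < p" "p < q" using Rats_dense_in_real[OF q(2)] by blast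
    have "q \<notin> A" using q(3) cInf_lower[OF _ bb] by force
    then have "eventually (\<lambda>x. p \<le> Q x) F" using dich[OF p(1) q(1) p(3)] q(1) by (auto simp: A_def)
    then show "eventually (\<lambda>x. a < Q x) F" using p(2) by (auto elim: eventually_mono)
  next
    fix a assume "Inf A < a"
    then obtain q where "q \<in> A" "q < a" using cInf_lessD \<open>q0 \<in> A\<close> by blast
    then show "eventually (\<lambda>x. Q x < a) F" by (auto simp: A_def elim: eventually_mono)
  qed
  then show ?thesis by blast
qed

text \<open>The slope bound is known only for intervals with \<open>x\<close> strictly inside.
  Letting the endpoint near \<open>x\<close> tend to \<open>x\<close> carries it over, by
  continuity, to the difference quotient at \<open>x\<close> itself.\<close>

lemma slope_ge_limit:
  fixes F :: "real \<Rightarrow> real"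
  assumes cont: "continuous_on UNIV F" and "d > 0"
    and ge: "\<And>s t. \<lbrakk>s < x; x < t; t - s < d\<rbrakk> \<Longrightarrow> p * (t - s) \<le> F t - F s"
    and y: "y \<noteq> x" "\<bar>y - x\<bar> < d"
  shows "p \<le> (F y - F x) / (y - x)"
proof (cases "x < y")
  case True
  have "((\<lambda>s. F y - F s - p * (y - s)) \<longlongrightarrow> F y - F x - p * (y - x)) (at_left x)"
    using cont by (intro tendsto_intros) (auto simp: continuous_on_def intro: tendsto_within_subset)
  moreover have "eventually (\<lambda>s. F y - F s - p * (y - s) \<ge> 0) (at_left x)"
    using eventually_at_left_real[of "y - d" x] y True ge[of _ y]
    by (auto elim!: eventually_mono)
  ultimately have "0 \<le> F y - F x - p * (y - x)"
    by (rule tendsto_lowerbound) simp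
  then show ?thesis using True by (simp add: field_simps)
next
  case False
  then have "y < x" using y by simp
  have "((\<lambda>t. F t - F y - p * (t - y)) \<longlongrightarrow> F x - F y - p * (x - y)) (at_right x)"
    using cont by (intro tendsto_intros) (auto simp: continuous_on_def intro: tendsto_within_subset)
  moreover have "eventually (\<lambda>t. F t - F y - p * (t - y) \<ge> 0) (at_right x)"
    using eventually_at_right_real[of x "y + d"] y \<open>y < x\<close> ge[of y]
    by (auto elim!: eventually_mono)
  ultimately have "0 \<le> F x - F y - p * (x - y)"
    by (rule tendsto_lowerbound) simp
  then show ?thesis using \<open>y < x\<close> by (simp add: field_simps)
qed

lemma slope_le_limit:
  fixes F :: "real \<Rightarrow> real"
  assumes cont: "continuous_on UNIV F" and "d > 0"
    and le: "\<And>s t. \<lbrakk>s < x; x < t; t - s < d\<rbrakk> \<Longrightarrow> F t - F s \<le> q * (t - s)"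
    and y: "y \<noteq> x" "\<bar>y - x\<bar> < d"
  shows "(F y - F x) / (y - x) \<le> q"
proof -
  have "- q \<le> (- F y - - F x) / (y - x)"
    by (rule slope_ge_limit[of "\<lambda>x. - F x" d])
      (use assms in \<open>auto intro!: continuous_intros simp: algebra_simps\<close>)
  then show ?thesis using y by (simp add: divide_simps split: if_splits)
qed

text \<open>Outside the countably many null sets \<open>slope_gap_set F p q\<close> with rational
  \<open>p < q\<close>, one of the two defining conditions fails at \<open>x\<close>. This gives the
  dichotomy for the difference quotients, which \<open>L\<close> bounds, and hence their
  convergence.\<close>

lemma mono_lipschitz_differentiable_AE:
  fixes F :: "real \<Rightarrow> real"
  assumes "mono F" and lip: "L-lipschitz_on UNIV F"
  shows "\<exists>N. negligible N \<and> (\<forall>x. x \<notin> N \<longrightarrow> (\<exists>l. (F has_real_derivative l) (at x)))"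
proof (rule exI, intro conjI allI impI)
  let ?R = "{(p, q) \<in> \<rat> \<times> \<rat>. p < (q::real)}"
  let ?N = "\<Union>(p, q)\<in>?R. slope_gap_set F p q"
  have cont: "continuous_on UNIV F" using lip lipschitz_on_continuous_on by blast
  have "countable ?R"
    by (rule countable_subset[of _ "\<rat> \<times> \<rat>"]) (auto intro: countable_rat)
  then show "negligible ?N"
    by (intro negligible_countable_Union) (auto intro: negligible_slope_gap_set[OF \<open>mono F\<close> cont])
  fix x assume x: "x \<notin> ?N"
  have "\<exists>l. ((\<lambda>y. (F y - F x) / (y - x)) \<longlongrightarrow> l) (at x)"
  proof (rule tendsto_real_of_rational_dichotomy)
    have "\<bar>(F y - F x) / (y - x)\<bar> \<le> L" if "y \<noteq> x" for y
      using lipschitz_onD[OF lip, of y x] that by (simp add: dist_real_def divide_simps)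
    then show "eventually (\<lambda>y. \<bar>(F y - F x) / (y - x)\<bar> \<le> L) (at x)"
      by (auto simp: eventually_at intro: exI[of _ 1])
  next
    fix p q :: real assume pq: "p \<in> \<rat>" "q \<in> \<rat>" "p < q"
    then have "x \<notin> slope_gap_set F p q" using x by auto
    then consider d where "d > 0" "\<And>s t. \<lbrakk>s < x; x < t; t - s < d\<rbrakk> \<Longrightarrow> p * (t - s) \<le> F t - F s"
      | d where "d > 0" "\<And>s t. \<lbrakk>s < x; x < t; t - s < d\<rbrakk> \<Longrightarrow> F t - F s \<le> q * (t - s)"
      unfolding slope_gap_set_def by (simp add: not_less) (metis not_less)
    then show "eventually (\<lambda>y. (F y - F x) / (y - x) \<le> q) (at x) \<or>
        eventually (\<lambda>y. p \<le> (F y - F x) / (y - x)) (at x)"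
    proof cases
      case 1
      then have "eventually (\<lambda>y. p \<le> (F y - F x) / (y - x)) (at x)"
        using slope_ge_limit[OF cont, of d x p] by (auto simp: eventually_at dist_real_def)
      then show ?thesis ..
    next
      case 2
      then have "eventually (\<lambda>y. (F y - F x) / (y - x) \<le> q) (at x)"
        using slope_le_limit[OF cont, of d x q] by (auto simp: eventually_at dist_real_def)
      then show ?thesis ..
    qed
  qed simp
  then show "\<exists>l. (F has_real_derivative l) (at x)"
    by (simp add: has_field_derivative_iff)
qed

lemma mono_on_lipschitz_differentiable_AE:
  fixes \<tau> :: "real \<Rightarrow> real"
  assumes "a \<le> b" and mono: "mono_on {a..b} \<tau>" and lip: "L-lipschitz_on {a..b} \<tau>"
  obtains g where "g \<in> borel_measurable borel" "\<And>t. 0 \<le> g t"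
    "AE t in lebesgue_on {a..b}. (\<tau> has_real_derivative g t) (at t within {a..b})"
proof -
  \<comment> \<open>Clamping the argument extends the function to the whole line with constant ends,
    keeping monotonicity and the Lipschitz constant.\<close>
  define F where "F x = \<tau> (max a (min b x))" for x
  have F_eq: "F x = \<tau> x" if "x \<in> {a..b}" for x using that by (simp add: F_def)
  have "mono F" using mono \<open>a \<le> b\<close> by (auto simp: mono_on_def F_def intro!: monoI)
  have lipF: "L-lipschitz_on UNIV F"
  proof (rule lipschitz_onI)
    fix x y :: real
    have "dist (F x) (F y) \<le> L * dist (max a (min b x)) (max a (min b y))"
      unfolding F_def using \<open>a \<le> b\<close> by (intro lipschitz_onD[OF lip]) auto
    also have "\<dots> \<le> L * dist x y"
      using lipschitz_on_nonneg[OF lip] by (intro mult_left_mono) (auto simp: dist_real_def)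
    finally show "dist (F x) (F y) \<le> L * dist x y" .
  qed (use lipschitz_on_nonneg[OF lip] in auto)
  have "continuous_on UNIV F" using lipF lipschitz_on_continuous_on by blast
  then have [measurable]: "F \<in> borel_measurable borel" by (rule borel_measurable_continuous_onI)
  \<comment> \<open>A limit along a fixed sequence is Borel measurable even where the sequence
    diverges. The maximum with 0 gives nonnegativity at the exceptional points as well.\<close>
  define g where "g x = max 0 (lim (\<lambda>n. (F (x + inverse (real (Suc n))) - F x) / inverse (real (Suc n))))" for x
  have "g \<in> borel_measurable borel"
    unfolding g_def by (intro borel_measurable_max borel_measurable_lim_metric) measurable
  moreover have "0 \<le> g t" for t by (simp add: g_def)
  moreover
  obtain N where N: "negligible N" "\<And>x. x \<notin> N \<Longrightarrow> \<exists>l. (F has_real_derivative l) (at x)"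
    using mono_lipschitz_differentiable_AE[OF \<open>mono F\<close> lipF] by blast
  have "(\<tau> has_real_derivative g t) (at t within {a..b})" if t: "t \<in> {a..b} - N" for t
  proof -
    obtain l where l: "(F has_real_derivative l) (at t)" using N t by blast
    have lim: "(\<lambda>n. (F (t + inverse (real (Suc n))) - F t) / inverse (real (Suc n))) \<longlonglongrightarrow> l"
      using l unfolding DERIV_def
      by (rule filterlim_compose) (auto simp: filterlim_at LIMSEQ_inverse_real_of_nat simp del: of_nat_Suc)
    have "0 \<le> l"
      using lim by (rule LIMSEQ_le_const)
        (use \<open>mono F\<close> in \<open>auto simp: mono_def intro!: exI[of _ 0] divide_nonneg_pos simp del: of_nat_Suc\<close>)
    then have "g t = l" using limI[OF lim] by (simp add: g_def)
    then have "(F has_real_derivative g t) (at t within {a..b})"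
      using l has_field_derivative_at_within by blast
    then show ?thesis
      by (rule has_field_derivative_transform_within[of _ _ _ _ 1]) (use t F_eq in auto)
  qed
  then have "AE t in lebesgue_on {a..b}. (\<tau> has_real_derivative g t) (at t within {a..b})"
    using N(1) by (auto simp: AE_lebesgue_on_iff_negligible)
  ultimately show thesis using that by blast
qed

subsection \<open>Geodesics\<close>

text \<open>Geodesics in the light-cone coordinates \<open>v = x + y\<close> and \<open>w = x - y\<close>: the coordinate \<open>w\<close>
  is obtained from \<open>v\<close> by changing the signs of \<open>\<psi>\<close> and \<open>c\<close>, and \<open>geo_time \<psi> c\<close> inverts
  \<open>geo_v \<psi> c\<close> where \<open>exp \<psi> + c * v > 0\<close>.\<close>

definition geo_v :: "real \<Rightarrow> real \<Rightarrow> real \<Rightarrow> real" where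
  "geo_v \<psi> c s = (if c = 0 then s * exp \<psi> else (exp (\<psi> + c * s) - exp \<psi>) / c)"

definition geo_z :: "real \<Rightarrow> real \<Rightarrow> real" where
  "geo_z c s = (if c = 0 then 0 else (sinh (c * s) - c * s) / (2 * c\<^sup>2))"

definition geo_time :: "real \<Rightarrow> real \<Rightarrow> real \<Rightarrow> real" where
  "geo_time \<psi> c v = (if c = 0 then v * exp (- \<psi>) else ln (1 + c * v * exp (- \<psi>)) / c)"

lemma sl_Exp_geo:
  "sl_Exp (\<psi>, c, s) =
    ((geo_v \<psi> c s + geo_v (- \<psi>) (- c) s) / 2, (geo_v \<psi> c s - geo_v (- \<psi>) (- c) s) / 2, geo_z c s)"
  by (auto simp: sl_Exp_def geo_v_def geo_z_def cosh_def sinh_def field_simps)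

lemma geo_v_0 [simp]: "geo_v \<psi> c 0 = 0"
  by (simp add: geo_v_def)

lemma geo_z_0 [simp]: "geo_z c 0 = 0"
  by (simp add: geo_z_def)

lemma exp_add_geo_v: "exp \<psi> + c * geo_v \<psi> c s = exp (\<psi> + c * s)"
  by (simp add: geo_v_def)

lemma geo_v_has_real_derivative [derivative_intros]:
  "(geo_v \<psi> c has_real_derivative exp (\<psi> + c * s)) (at s within S)"
proof (cases "c = 0")
  case True
  then have "geo_v \<psi> c = (\<lambda>s. s * exp \<psi>)" by (auto simp: geo_v_def)
  then show ?thesis using True by (auto intro!: derivative_eq_intros)
next
  case False
  then have "geo_v \<psi> c = (\<lambda>s. (exp (\<psi> + c * s) - exp \<psi>) / c)" by (auto simp: geo_v_def)
  then show ?thesis using False by (auto intro!: derivative_eq_intros)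
qed

text \<open>The parameter \<open>\<psi>\<close> cancels on the right. The derivative is written as
  \<open>(w a - v b) / 4\<close>, with the controls of the geodesic, to match the equation for
  \<open>z\<close> along a causal curve.\<close>

lemma geo_z_has_real_derivative:
  "(geo_z c has_real_derivative
    (geo_v (- \<psi>) (- c) s * exp (\<psi> + c * s) - geo_v \<psi> c s * exp (- \<psi> - c * s)) / 4) (at s within S)"
proof (cases "c = 0")
  case True
  then have "geo_z c = (\<lambda>s. 0)" by (auto simp: geo_z_def)
  then show ?thesis using True by (auto simp: geo_v_def exp_minus)
next
  case False
  then have eq: "geo_z c = (\<lambda>s. (sinh (c * s) - c * s) / (2 * c\<^sup>2))" by (auto simp: geo_z_def)
  have "(geo_v (- \<psi>) (- c) s * exp (\<psi> + c * s) - geo_v \<psi> c s * exp (- \<psi> - c * s)) / 4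
      = (cosh (c * s) - 1) / (2 * c)"
    using False by (simp add: geo_v_def cosh_def exp_add exp_diff exp_minus field_simps)
  moreover have "(geo_z c has_real_derivative (cosh (c * s) - 1) / (2 * c)) (at s within S)"
    unfolding eq using False by (auto intro!: derivative_eq_intros simp: field_simps power2_eq_square)
  ultimately show ?thesis by (simp only:)
qed

lemma geo_time_geo_v: "geo_time \<psi> c (geo_v \<psi> c s) = s"
proof (cases "c = 0")
  case False
  have "1 + c * geo_v \<psi> c s * exp (- \<psi>) = exp (- \<psi>) * (exp \<psi> + c * geo_v \<psi> c s)"
    by (simp add: algebra_simps exp_minus)
  also have "\<dots> = exp (c * s)" by (simp add: exp_add_geo_v exp_add[symmetric])
  finally show ?thesis using False by (simp add: geo_time_def)
qed (simp add: geo_time_def geo_v_def exp_minus)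

lemma exp_geo_time:
  assumes "exp \<psi> + c * v > 0"
  shows "exp (\<psi> + c * geo_time \<psi> c v) = exp \<psi> + c * v"
proof (cases "c = 0")
  case False
  have eq: "1 + c * v * exp (- \<psi>) = exp (- \<psi>) * (exp \<psi> + c * v)"
    by (simp add: algebra_simps exp_minus)
  have "c * geo_time \<psi> c v = ln (exp (- \<psi>) * (exp \<psi> + c * v))"
    using False by (simp add: geo_time_def eq)
  also have "\<dots> = - \<psi> + ln (exp \<psi> + c * v)" using assms by (simp add: ln_mult)
  finally show ?thesis using assms by simp
qed simp

lemma geo_v_geo_time:
  assumes "exp \<psi> + c * v > 0"
  shows "geo_v \<psi> c (geo_time \<psi> c v) = v"
  using exp_geo_time[OF assms] by (cases "c = 0") (auto simp: geo_v_def geo_time_def exp_minus)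

lemma geo_time_has_real_derivative:
  assumes "exp \<psi> + c * v > 0"
  shows "(geo_time \<psi> c has_real_derivative 1 / (exp \<psi> + c * v)) (at v within S)"
proof (cases "c = 0")
  case True
  then have "geo_time \<psi> c = (\<lambda>v. v * exp (- \<psi>))" by (auto simp: geo_time_def)
  then show ?thesis using True by (auto intro!: derivative_eq_intros simp: exp_minus field_simps)
next
  case False
  then have eq: "geo_time \<psi> c = (\<lambda>v. ln (1 + c * v * exp (- \<psi>)) / c)" by (auto simp: geo_time_def)
  have eq': "1 + c * v * exp (- \<psi>) = exp (- \<psi>) * (exp \<psi> + c * v)"
    by (simp add: algebra_simps exp_minus)
  then have "1 + c * v * exp (- \<psi>) > 0" using assms by (simp add: zero_less_mult_iff)
  then have "(geo_time \<psi> c has_real_derivative (c * exp (- \<psi>) / (1 + c * v * exp (- \<psi>))) / c) (at v within S)"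
    unfolding eq by (auto intro!: derivative_eq_intros)
  then show ?thesis unfolding eq' using False assms by simp
qed

text \<open>For \<open>c\<close> nonzero the two terms containing
  \<open>geo_v (- \<psi>) (- c) s\<close> add up to \<open>sinh (c * s) / (2 * c)\<close>, and
  subtracting \<open>c * geo_z c s\<close> leaves \<open>s / 2\<close>. The other half is the
  \<open>geo_time\<close> term. So the calibration measures time along the geodesic.\<close>

lemma geo_calibration_value:
  "geo_time \<psi> c (geo_v \<psi> c s) / 2 + exp \<psi> * geo_v (- \<psi>) (- c) s / 2
     + c * (geo_v \<psi> c s * geo_v (- \<psi>) (- c) s) / 4 - c * geo_z c s = s"
proof (cases "c = 0")
  case True
  then show ?thesis unfolding geo_time_geo_v
    by (simp add: geo_v_def geo_z_def exp_minus field_simps)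
next
  case False
  then show ?thesis unfolding geo_time_geo_v
    by (simp add: geo_v_def geo_z_def sinh_def exp_add exp_minus exp_diff field_simps power2_eq_square)
qed

subsection \<open>Causal curves and the calibration\<close>

text \<open>Trajectories from \<open>q0\<close> in the light-cone coordinates \<open>v = x + y\<close>, \<open>w = x - y\<close>, with
  controls \<open>a = u1 + u2\<close>, \<open>b = u1 - u2\<close>.\<close>

locale causal_curve =
  fixes T :: real and v w z a b :: "real \<Rightarrow> real"
  assumes T: "0 < T"
    and lip_v: "\<exists>L. L-lipschitz_on {0..T} v"
    and lip_w: "\<exists>L. L-lipschitz_on {0..T} w"
    and lip_z: "\<exists>L. L-lipschitz_on {0..T} z"
    and start: "v 0 = 0" "w 0 = 0" "z 0 = 0"
    and meas [measurable]: "a \<in> borel_measurable (lebesgue_on {0..T})"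
      "b \<in> borel_measurable (lebesgue_on {0..T})"
    and nonneg: "AE t in lebesgue_on {0..T}. 0 \<le> a t \<and> 0 \<le> b t"
    and der_v: "AE t in lebesgue_on {0..T}. (v has_real_derivative a t) (at t within {0..T})"
    and der_w: "AE t in lebesgue_on {0..T}. (w has_real_derivative b t) (at t within {0..T})"
    and der_z: "AE t in lebesgue_on {0..T}.
      (z has_real_derivative (w t * a t - v t * b t) / 4) (at t within {0..T})"
begin

lemma AE_subinterval:
  assumes "AE t in lebesgue_on {0..T}. P t" "0 \<le> r" "s \<le> T"
  shows "AE t in lebesgue_on {r..s}. P t"
  using assms by (intro AE_lebesgue_on_subset[OF assms(1)]) auto

lemma nonneg_derivative_imp_mono_on:
  assumes lip: "\<exists>L. L-lipschitz_on {0..T} F"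
    and der: "AE t in lebesgue_on {0..T}. (F has_real_derivative f t) (at t within {0..T})"
    and nn: "AE t in lebesgue_on {0..T}. 0 \<le> f t"
  shows "mono_on {0..T} F"
proof (rule mono_onI)
  fix r s assume rs: "r \<in> {0..T}" "s \<in> {0..T}" "r \<le> s"
  obtain L where L: "L-lipschitz_on {0..T} F" using lip by blast
  have "AE t in lebesgue_on {0..T}. (F has_real_derivative f t) (at t within {0..T}) \<and> 0 \<le> f t"
    using der nn by eventually_elim simp
  then have "AE t in lebesgue_on {r..s}. (F has_real_derivative f t) (at t within {0..T}) \<and> 0 \<le> f t"
    by (rule AE_subinterval) (use rs in auto)
  then have "AE t in lebesgue_on {r..s}. (F has_vector_derivative f t) (at t within {r..s}) \<and> 0 \<le> f t"
    by eventually_elim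
      (use rs in \<open>auto simp: has_real_derivative_iff_has_vector_derivative
        intro: has_vector_derivative_within_subset\<close>)
  then show "F r \<le> F s"
    using rs by (intro lipschitz_nonneg_derivative_imp_le[OF _ lipschitz_on_subset[OF L]]) auto
qed

lemma mono_v: "mono_on {0..T} v"
  by (rule nonneg_derivative_imp_mono_on[OF lip_v der_v]) (use nonneg in \<open>auto elim!: eventually_mono\<close>)

lemma pos_derivative_imp_less:
  assumes lip: "\<exists>L. L-lipschitz_on {0..T} F"
    and der: "AE t in lebesgue_on {0..T}. (F has_real_derivative f t) (at t within {0..T})"
    and pos: "AE t in lebesgue_on {0..T}. 0 < f t"
    and s: "0 < s" "s \<le> T"
  shows "F 0 < F s"
proof -
  obtain L where L: "L-lipschitz_on {0..T} F" using lip by blast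
  have "AE t in lebesgue_on {0..s}. (F has_real_derivative f t) (at t within {0..T})"
    by (rule AE_subinterval[OF der]) (use s in auto)
  then have "AE t in lebesgue_on {0..s}. (F has_vector_derivative f t) (at t within {0..s})"
    by eventually_elim
      (use s in \<open>auto simp: has_real_derivative_iff_has_vector_derivative
        intro: has_vector_derivative_within_subset\<close>)
  moreover have "AE t in lebesgue_on {0..s}. 0 < f t"
    by (rule AE_subinterval[OF pos]) (use s in auto)
  ultimately show ?thesis
    using s by (intro lipschitz_pos_derivative_imp_less[OF _ lipschitz_on_subset[OF L]]) auto
qed

text \<open>The functions \<open>v w + 4 z\<close> and \<open>v w - 4 z\<close> start at 0 and have
  derivatives \<open>2 a w\<close> and \<open>2 b v\<close>, which are positive almost everywhere
  once \<open>v\<close> and \<open>w\<close> are known to be positive after time 0.\<close>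

lemma timelike_end:
  assumes pos: "AE t in lebesgue_on {0..T}. 0 < a t \<and> 0 < b t"
  shows "0 < v T" "0 < w T" "4 * \<bar>z T\<bar> < v T * w T"
proof -
  have pv: "0 < v s" if "0 < s" "s \<le> T" for s
    using pos_derivative_imp_less[OF lip_v der_v _ that] pos start by (auto elim!: eventually_mono)
  have pw: "0 < w s" if "0 < s" "s \<le> T" for s
    using pos_derivative_imp_less[OF lip_w der_w _ that] pos start by (auto elim!: eventually_mono)
  have nz: "AE t in lebesgue_on {0..T}. 0 < t \<and> t \<le> T"
    by (subst AE_lebesgue_on_iff_negligible) (auto intro!: exI[of _ "{0}"])
  have ex: "\<exists>L. L-lipschitz_on {0..T} (\<lambda>t. v t * w t + e * z t)" for e
    by (rule lipschitz_on_add_cmult[OF lipschitz_on_mult_real[OF lip_v lip_w] lip_z])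
  have less: "(\<lambda>t. v t * w t + e * z t) 0 < v T * w T + e * z T" if e: "e = 4 \<or> e = -4" for e
  proof (rule pos_derivative_imp_less[OF ex])
    show "AE t in lebesgue_on {0..T}. ((\<lambda>t. v t * w t + e * z t) has_real_derivative
        (a t * w t + v t * b t + e * ((w t * a t - v t * b t) / 4))) (at t within {0..T})"
      using der_v der_w der_z
      by eventually_elim (auto intro!: derivative_eq_intros)
    show "AE t in lebesgue_on {0..T}. 0 < a t * w t + v t * b t + e * ((w t * a t - v t * b t) / 4)"
      using pos nz
    proof eventually_elim
      case (elim t)
      then have "0 < a t * w t" "0 < v t * b t" using pv[of t] pw[of t] by auto
      then show ?case using e by (elim disjE) (simp_all add: field_simps)
    qed
  qed (use T in auto)
  show "0 < v T" "0 < w T" using pv pw T by auto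
  show "4 * \<bar>z T\<bar> < v T * w T" using less[of 4] less[of "-4"] start by auto
qed

end

section \<open>Calibration of causal curves that end on a geodesic\<close>

locale calibrated_curve = causal_curve +
  fixes \<psi> c t1 :: real
  assumes t1: "0 < t1"
    and end_v: "v T = geo_v \<psi> c t1" and end_w: "w T = geo_v (- \<psi>) (- c) t1" and end_z: "z T = geo_z c t1"
begin

definition exp_angle where "exp_angle t = exp \<psi> + c * v t"

lemma v_bounds: "t \<in> {0..T} \<Longrightarrow> 0 \<le> v t \<and> v t \<le> v T"
  using mono_onD[OF mono_v, of 0 t] mono_onD[OF mono_v, of t T] T start by auto

text \<open>The expression is affine in \<open>r\<close> and positive at both ends of the range: it
  equals \<open>exp \<psi>\<close> at 0 and \<open>exp (\<psi> + c * t1)\<close> at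
  \<open>v T\<close>. Since \<open>v\<close> is monotone it stays in this range, so the logarithm in
  the calibration is defined along the whole curve.\<close>

lemma pos_on_range:
  assumes "0 \<le> r" "r \<le> v T"
  shows "exp \<psi> + c * r > 0"
proof (cases "c \<ge> 0")
  case False
  then have "c * v T \<le> c * r" using assms by (intro mult_left_mono_neg) auto
  then have "exp \<psi> + c * r \<ge> exp (\<psi> + c * t1)" using exp_add_geo_v[of \<psi> c t1] end_v by simp
  then show ?thesis using exp_gt_zero less_le_trans by blast
qed (use assms in \<open>auto intro: add_pos_nonneg\<close>)

lemma exp_angle_pos: "t \<in> {0..T} \<Longrightarrow> 0 < exp_angle t"
  using pos_on_range v_bounds by (simp add: exp_angle_def)

text \<open>The candidate time change: the time at which the geodesic has the same coordinate
  \<open>v\<close> as the curve.\<close>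

definition \<sigma> where "\<sigma> t = geo_time \<psi> c (v t)"

lemma geo_v_\<sigma>: "t \<in> {0..T} \<Longrightarrow> geo_v \<psi> c (\<sigma> t) = v t"
  using geo_v_geo_time exp_angle_pos by (simp add: exp_angle_def \<sigma>_def)

lemma exp_\<sigma>: "t \<in> {0..T} \<Longrightarrow> exp (\<psi> + c * \<sigma> t) = exp_angle t"
  using exp_geo_time exp_angle_pos by (simp add: exp_angle_def \<sigma>_def)

lemma lip_\<sigma>: "\<exists>L. L-lipschitz_on {0..T} \<sigma>"
proof -
  have "\<exists>L. L-lipschitz_on {0..v T} (geo_time \<psi> c)"
    by (rule continuous_vector_derivative_imp_lipschitz[where f' = "\<lambda>r. 1 / (exp \<psi> + c * r)"])
      (use pos_on_range in \<open>fastforce simp flip: has_real_derivative_iff_has_vector_derivative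
        intro!: geo_time_has_real_derivative continuous_intros\<close>)+
  then obtain L where L: "L-lipschitz_on {0..v T} (geo_time \<psi> c)" by blast
  obtain M where M: "M-lipschitz_on {0..T} v" using lip_v by blast
  have "v ` {0..T} \<subseteq> {0..v T}" using v_bounds by auto
  then show ?thesis unfolding \<sigma>_def
    using lipschitz_on_compose2[OF M lipschitz_on_subset[OF L]] by blast
qed

lemma der_\<sigma>: "AE t in lebesgue_on {0..T}. (\<sigma> has_real_derivative a t / exp_angle t) (at t within {0..T})"
proof -
  have "AE t in lebesgue_on {0..T}. t \<in> {0..T}"
    using AE_space[of "lebesgue_on {0..T}"] by (simp add: space_restrict_space)
  then show ?thesis using der_v
  proof eventually_elim
    case (elim t)
    have "(geo_time \<psi> c \<circ> v has_real_derivative 1 / exp_angle t * a t) (at t within {0..T})"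
      using elim(2) geo_time_has_real_derivative[of \<psi> c "v t"] exp_angle_pos[OF elim(1)]
      by (intro DERIV_image_chain) (auto simp: exp_angle_def)
    then show ?case by (simp add: \<sigma>_def[abs_def] comp_def)
  qed
qed

lemma \<sigma>_0: "\<sigma> 0 = 0" and \<sigma>_T: "\<sigma> T = t1"
  using geo_time_geo_v[of \<psi> c 0] start end_v by (simp_all add: \<sigma>_def geo_time_geo_v)

lemma AE_in_interval: "AE t in lebesgue_on {0..T}. t \<in> {0..T}"
  using AE_space[of "lebesgue_on {0..T}"] by (simp add: space_restrict_space)

lemma mono_\<sigma>: "mono_on {0..T} \<sigma>"
  by (rule nonneg_derivative_imp_mono_on[OF lip_\<sigma> der_\<sigma>])
    (use nonneg AE_in_interval in \<open>eventually_elim, use exp_angle_pos in fastforce\<close>)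

lemma \<sigma>_in: "t \<in> {0..T} \<Longrightarrow> \<sigma> t \<in> {0..t1}"
  using mono_onD[OF mono_\<sigma>, of 0 t] mono_onD[OF mono_\<sigma>, of t T] T \<sigma>_0 \<sigma>_T by auto

lemma \<sigma>_image: "\<sigma> ` {0..T} = {0..t1}"
proof
  show "\<sigma> ` {0..T} \<subseteq> {0..t1}" using \<sigma>_in by blast
  have "continuous_on {0..T} \<sigma>" using lip_\<sigma> lipschitz_on_continuous_on by blast
  then have "\<exists>t\<ge>0. t \<le> T \<and> \<sigma> t = y" if "y \<in> {0..t1}" for y
    using that T \<sigma>_0 \<sigma>_T by (intro IVT') auto
  then show "{0..t1} \<subseteq> \<sigma> ` {0..T}" by (metis atLeastAtMost_iff image_eqI subsetI)
qed

text \<open>The redundant \<open>0\<close> and the factored coefficients give the shape of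
  \<open>lipschitz_on_add_cmult\<close>.\<close>

definition calib where
  "calib t = 0 + 1 / 2 * \<sigma> t + exp \<psi> / 2 * w t + c / 4 * (v t * w t) + (- c) * z t"

definition calib_rate where "calib_rate t = (a t / exp_angle t + b t * exp_angle t) / 2"

lemma lip_calib: "\<exists>L. L-lipschitz_on {0..T} calib"
  unfolding calib_def using lipschitz_on_constant
  by (intro lipschitz_on_add_cmult lipschitz_on_mult_real lip_v lip_w lip_z lip_\<sigma>) blast

text \<open>In the derivative of \<open>c / 4 * (v w) - c * z\<close> the terms with
  \<open>a w\<close> cancel, and those with \<open>b v\<close> combine to \<open>c v b / 2\<close>.
  Together with \<open>exp \<psi> * b / 2\<close> this is \<open>exp_angle t * b t / 2\<close>,
  while \<open>\<sigma>\<close> contributes the other half of \<open>calib_rate\<close>.\<close>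

lemma der_calib: "AE t in lebesgue_on {0..T}. (calib has_real_derivative calib_rate t) (at t within {0..T})"
  using der_\<sigma> der_v der_w der_z AE_in_interval
proof eventually_elim
  case (elim t)
  have "exp_angle t > 0" using exp_angle_pos elim by blast
  show ?case unfolding calib_def[abs_def]
    using elim(1-4) \<open>exp_angle t > 0\<close>
    by (auto intro!: derivative_eq_intros simp: calib_rate_def exp_angle_def field_simps)
qed

lemma calib_rate_has_integral: "(calib_rate has_integral t1) {0..T}"
proof -
  obtain L where L: "L-lipschitz_on {0..T} calib" using lip_calib by blast
  have "(calib_rate has_integral (calib T - calib 0)) {0..T}"
    using der_calib T by (intro lipschitz_fundamental_theorem_AE[OF _ L])
      (auto simp: has_real_derivative_iff_has_vector_derivative)
  moreover have "calib 0 = 0" by (simp add: calib_def \<sigma>_0 start)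
  moreover have "calib T = t1"
    using geo_calibration_value[of \<psi> c t1] end_v end_w end_z by (simp add: calib_def \<sigma>_def)
  ultimately show ?thesis by simp
qed

lemma speed_le_calib_rate: "AE t in lebesgue_on {0..T}. sqrt (a t * b t) \<le> calib_rate t"
  using nonneg AE_in_interval
proof eventually_elim
  case (elim t)
  have "exp_angle t > 0" using exp_angle_pos elim by blast
  then show ?case
    using arith_geo_mean_sqrt[of "a t / exp_angle t" "b t * exp_angle t"] elim by (simp add: calib_rate_def)
qed

lemma speed_nonneg: "AE t in lebesgue_on {0..T}. 0 \<le> sqrt (a t * b t)"
  using nonneg by eventually_elim simp

text \<open>The speed is dominated by a Lebesgue integrable version \<open>f\<close> of
  \<open>calib_rate\<close> with integral \<open>t1\<close>. If the integrals agree, the nonnegative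
  difference vanishes almost everywhere.\<close>

lemma length_le: "(LINT t|lebesgue_on {0..T}. sqrt (a t * b t)) \<le> t1"
  and length_eq_imp: "(LINT t|lebesgue_on {0..T}. sqrt (a t * b t)) = t1 \<Longrightarrow>
    AE t in lebesgue_on {0..T}. b t = a t / (exp_angle t)\<^sup>2"
proof -
  have "AE t in lebesgue_on {0..T}. 0 \<le> calib_rate t"
    using speed_le_calib_rate speed_nonneg by eventually_elim linarith
  from has_integral_AE_nonneg[OF calib_rate_has_integral this]
  obtain f where f: "integrable (lebesgue_on {0..T}) f" "AE t in lebesgue_on {0..T}. f t = calib_rate t"
    "\<And>t. 0 \<le> f t" "integral\<^sup>L (lebesgue_on {0..T}) f = t1" by metis
  have le: "AE t in lebesgue_on {0..T}. sqrt (a t * b t) \<le> f t"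
    using f(2) speed_le_calib_rate by eventually_elim simp
  have int: "integrable (lebesgue_on {0..T}) (\<lambda>t. sqrt (a t * b t))"
  proof (rule Bochner_Integration.integrable_bound[OF f(1)])
    show "AE t in lebesgue_on {0..T}. norm (sqrt (a t * b t)) \<le> norm (f t)"
      using le speed_nonneg by eventually_elim simp
  qed measurable
  show "(LINT t|lebesgue_on {0..T}. sqrt (a t * b t)) \<le> t1"
    using integral_mono_AE[OF int f(1) le] f(4) by simp
  assume eq: "(LINT t|lebesgue_on {0..T}. sqrt (a t * b t)) = t1"
  have "AE t in lebesgue_on {0..T}. f t - sqrt (a t * b t) = 0"
  proof (subst integral_nonneg_eq_0_iff_AE[symmetric])
    show "AE t in lebesgue_on {0..T}. 0 \<le> f t - sqrt (a t * b t)"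
      using le by eventually_elim simp
  qed (use int f(1,4) eq in auto)
  with f(2) nonneg AE_in_interval
  show "AE t in lebesgue_on {0..T}. b t = a t / (exp_angle t)\<^sup>2"
  proof eventually_elim
    case (elim t)
    have P: "exp_angle t > 0" using exp_angle_pos elim by blast
    \<comment> \<open>The geometric mean of \<open>A\<close> and \<open>B\<close> is the speed and
      their arithmetic mean is \<open>calib_rate\<close>; equality of the two means forces
      \<open>A = B\<close>.\<close>
    define A B where "A = a t / exp_angle t" and "B = b t * exp_angle t"
    have AB: "a t * b t = A * B" "A \<ge> 0" "B \<ge> 0" using P elim by (auto simp: A_def B_def)
    have "(A + B) / 2 = sqrt (A * B)" using elim AB(1) by (simp add: calib_rate_def A_def B_def)
    then have "((A + B) / 2)\<^sup>2 = A * B" using AB by simp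
    then have "(A - B)\<^sup>2 = 0" by (simp add: power2_eq_square field_simps)
    then have "A = B" by simp
    then show ?case using P by (simp add: A_def B_def power2_eq_square field_simps)
  qed
qed

section \<open>The equality case: the curve is a time-changed geodesic\<close>

lemma lip_comp_\<sigma>:
  assumes der: "\<And>s. (f has_real_derivative f' s) (at s within {0..t1})"
    and cont: "continuous_on {0..t1} f'"
  shows "\<exists>L. L-lipschitz_on {0..T} (\<lambda>t. f (\<sigma> t))"
proof -
  obtain L where L: "L-lipschitz_on {0..t1} f"
    using continuous_vector_derivative_imp_lipschitz[of 0 t1 f f'] der cont
    by (auto simp: has_real_derivative_iff_has_vector_derivative)
  obtain M where M: "M-lipschitz_on {0..T} \<sigma>" using lip_\<sigma> by blast
  have "\<sigma> ` {0..T} \<subseteq> {0..t1}" using \<sigma>_in by blast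
  then show ?thesis using lipschitz_on_compose2[OF M lipschitz_on_subset[OF L]] by blast
qed

text \<open>The difference of the two sides is Lipschitz, has derivative 0 almost everywhere by the
  chain rule, and vanishes at 0 because \<open>\<sigma> 0 = 0\<close>.\<close>

lemma eq_comp_\<sigma>:
  assumes lip: "\<exists>L. L-lipschitz_on {0..T} F" and "F 0 = f 0"
    and der: "\<And>s S. (f has_real_derivative f' s) (at s within S)"
    and cont: "continuous_on {0..t1} f'"
    and derF: "AE t in lebesgue_on {0..T}. (F has_real_derivative f' (\<sigma> t) * (a t / exp_angle t)) (at t within {0..T})"
    and t: "t \<in> {0..T}"
  shows "F t = f (\<sigma> t)"
proof -
  obtain L where L: "L-lipschitz_on {0..T} (\<lambda>t. F t + (- 1) * f (\<sigma> t))"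
    using lipschitz_on_add_cmult[OF lip lip_comp_\<sigma>[OF der cont], of "- 1"] by blast
  have "AE t in lebesgue_on {0..T}. ((\<lambda>t. F t + (- 1) * f (\<sigma> t)) has_vector_derivative 0) (at t within {0..T})"
    using derF der_\<sigma>
  proof eventually_elim
    case (elim t)
    have "((\<lambda>t. f (\<sigma> t)) has_real_derivative f' (\<sigma> t) * (a t / exp_angle t)) (at t within {0..T})"
      using DERIV_image_chain[OF der elim(2)] by (simp add: comp_def)
    from DERIV_add[OF elim(1) DERIV_cmult[OF this, of "- 1"]]
    show ?case by (simp add: has_real_derivative_iff_has_vector_derivative)
  qed
  from lipschitz_zero_derivative_imp_eq[OF L t this] show ?thesis
    using \<open>F 0 = f 0\<close> by (simp add: \<sigma>_0)
qed

text \<open>The coordinate \<open>v\<close> agrees with the geodesic by the choice of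
  \<open>\<sigma>\<close>. Since \<open>exp (- \<psi> - c * \<sigma> t)\<close> is
  \<open>1 / exp_angle t\<close>, the relation \<open>b = a / exp_angle\<^sup>2\<close> says that
  \<open>w\<close> obeys the geodesic equation in the time \<open>\<sigma>\<close>. The equation for
  \<open>z\<close> contains \<open>w\<close> and is therefore treated last.\<close>

lemma length_eq_imp_geodesic:
  assumes eq: "(LINT t|lebesgue_on {0..T}. sqrt (a t * b t)) = t1" and t: "t \<in> {0..T}"
  shows "w t = geo_v (- \<psi>) (- c) (\<sigma> t)" "z t = geo_z c (\<sigma> t)"
proof -
  have exp_minus_\<sigma>: "exp (- \<psi> - c * \<sigma> t) = 1 / exp_angle t" if "t \<in> {0..T}" for t
    using exp_\<sigma>[OF that] exp_minus[of "\<psi> + c * \<sigma> t"] by (simp add: field_simps)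
  have w: "w t = geo_v (- \<psi>) (- c) (\<sigma> t)" if "t \<in> {0..T}" for t
  proof (rule eq_comp_\<sigma>[OF lip_w _ geo_v_has_real_derivative _ _ that])
    show "AE t in lebesgue_on {0..T}.
        (w has_real_derivative exp (- \<psi> + - c * \<sigma> t) * (a t / exp_angle t)) (at t within {0..T})"
      using length_eq_imp[OF eq] der_w AE_in_interval
      by eventually_elim (use exp_minus_\<sigma> in \<open>simp add: power2_eq_square\<close>)
  qed (auto simp: start intro!: continuous_intros)
  then show "w t = geo_v (- \<psi>) (- c) (\<sigma> t)" using t by blast
  show "z t = geo_z c (\<sigma> t)"
  proof (rule eq_comp_\<sigma>[OF lip_z _ geo_z_has_real_derivative _ _ t])
    show "AE t in lebesgue_on {0..T}. (z has_real_derivative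
        (geo_v (- \<psi>) (- c) (\<sigma> t) * exp (\<psi> + c * \<sigma> t) - geo_v \<psi> c (\<sigma> t) * exp (- \<psi> - c * \<sigma> t)) / 4
          * (a t / exp_angle t)) (at t within {0..T})"
      using length_eq_imp[OF eq] der_z AE_in_interval
    proof eventually_elim
      case (elim t)
      have "exp_angle t > 0" using exp_angle_pos elim by blast
      then have eq: "(w t * a t - v t * b t) / 4 = (w t * exp_angle t - v t * (1 / exp_angle t)) / 4 * (a t / exp_angle t)"
        using elim(1) by (simp add: power2_eq_square field_simps)
      show ?case
        using elim(2) unfolding eq geo_v_\<sigma>[OF elim(3)] w[OF elim(3), symmetric] exp_\<sigma>[OF elim(3)]
          exp_minus_\<sigma>[OF elim(3)] .
    qed
    have "continuous_on {0..t1} (geo_v \<psi> c)" for \<psi> c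
      using geo_v_has_real_derivative by (intro DERIV_continuous_on) blast
    then show "continuous_on {0..t1} (\<lambda>s. (geo_v (- \<psi>) (- c) s * exp (\<psi> + c * s)
        - geo_v \<psi> c s * exp (- \<psi> - c * s)) / 4)"
      by (intro continuous_intros) auto
  qed (simp add: start)
qed

end

subsection \<open>Trajectories and reparametrizations\<close>

text \<open>Stating this for any \<open>U\<close> inside \<open>U_full\<close> lets the same length
  bound serve the full and the reduced problem.\<close>

lemma trajectory_causal_curve:
  assumes tr: "trajectory U q0 q1 T q u" and U: "U \<subseteq> U_full"
  shows "causal_curve T (\<lambda>t. fst (q t) + fst (snd (q t))) (\<lambda>t. fst (q t) - fst (snd (q t)))
    (\<lambda>t. snd (snd (q t))) (\<lambda>t. fst (u t) + snd (u t)) (\<lambda>t. fst (u t) - snd (u t))"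
proof -
  from tr obtain L where T: "0 < T" and start: "q 0 = q0" and L: "L-lipschitz_on {0..T} q"
    and meas: "u \<in> borel_measurable (lebesgue_on {0..T})"
    and ae: "AE t in lebesgue_on {0..T}. u t \<in> U \<and>
        (q has_vector_derivative (fst (u t) *\<^sub>R X1 (q t) + snd (u t) *\<^sub>R X2 (q t))) (at t within {0..T})"
    unfolding trajectory_def by blast
  have comp: "dist (fst p) (fst r) \<le> dist p r" "dist (fst (snd p)) (fst (snd r)) \<le> dist p r"
    "dist (snd (snd p)) (snd (snd r)) \<le> dist p r" for p r :: heis
    using dist_fst_le[of p r] dist_snd_le[of p r] dist_fst_le[of "snd p" "snd r"]
      dist_snd_le[of "snd p" "snd r"] by linarith+
  have lip: "L-lipschitz_on {0..T} (\<lambda>t. fst (q t))" "L-lipschitz_on {0..T} (\<lambda>t. fst (snd (q t)))"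
    "L-lipschitz_on {0..T} (\<lambda>t. snd (snd (q t)))"
    using L comp lipschitz_on_nonneg[OF L] unfolding lipschitz_on_def by (meson order_trans)+
  have der: "AE t in lebesgue_on {0..T}.
      ((\<lambda>t. fst (q t)) has_real_derivative fst (u t)) (at t within {0..T}) \<and>
      ((\<lambda>t. fst (snd (q t))) has_real_derivative snd (u t)) (at t within {0..T}) \<and>
      ((\<lambda>t. snd (snd (q t))) has_real_derivative
        (fst (q t) * snd (u t) - fst (snd (q t)) * fst (u t)) / 2) (at t within {0..T})"
    using ae
  proof eventually_elim
    case (elim t)
    let ?D = "fst (u t) *\<^sub>R X1 (q t) + snd (u t) *\<^sub>R X2 (q t)"
    have q: "(q has_vector_derivative ?D) (at t within {0..T})" using elim by simp
    have D: "fst ?D = fst (u t)" "fst (snd ?D) = snd (u t)"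
      "snd (snd ?D) = (fst (q t) * snd (u t) - fst (snd (q t)) * fst (u t)) / 2"
      by (auto simp: X1_def X2_def split_beta field_simps)
    show ?case
      using bounded_linear.has_vector_derivative[OF bounded_linear_fst q]
        bounded_linear.has_vector_derivative[OF bounded_linear_fst
          bounded_linear.has_vector_derivative[OF bounded_linear_snd q]]
        bounded_linear.has_vector_derivative[OF bounded_linear_snd
          bounded_linear.has_vector_derivative[OF bounded_linear_snd q]]
      unfolding D has_real_derivative_iff_has_vector_derivative by blast
  qed
  show ?thesis
  proof
    show "0 < T" by fact
    show "\<exists>L. L-lipschitz_on {0..T} (\<lambda>t. fst (q t) + fst (snd (q t)))"
      "\<exists>L. L-lipschitz_on {0..T} (\<lambda>t. fst (q t) - fst (snd (q t)))"
      "\<exists>L. L-lipschitz_on {0..T} (\<lambda>t. snd (snd (q t)))"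
      using lip lipschitz_on_add lipschitz_on_diff by blast+
    show "(\<lambda>t. fst (u t) + snd (u t)) \<in> borel_measurable (lebesgue_on {0..T})"
      "(\<lambda>t. fst (u t) - snd (u t)) \<in> borel_measurable (lebesgue_on {0..T})"
      by (rule measurable_compose[OF meas], intro borel_measurable_continuous_onI continuous_intros)+
    show "AE t in lebesgue_on {0..T}. 0 \<le> fst (u t) + snd (u t) \<and> 0 \<le> fst (u t) - snd (u t)"
      using ae
    proof eventually_elim
      case (elim t)
      then have "u t \<in> U_full" using U by blast
      then show ?case by (auto simp: U_full_def split_beta)
    qed
    show "AE t in lebesgue_on {0..T}.
        ((\<lambda>t. fst (q t) + fst (snd (q t))) has_real_derivative fst (u t) + snd (u t)) (at t within {0..T})"
      using der by eventually_elim (auto intro: DERIV_add)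
    show "AE t in lebesgue_on {0..T}.
        ((\<lambda>t. fst (q t) - fst (snd (q t))) has_real_derivative fst (u t) - snd (u t)) (at t within {0..T})"
      using der by eventually_elim (auto intro: DERIV_diff)
    show "AE t in lebesgue_on {0..T}. ((\<lambda>t. snd (snd (q t))) has_real_derivative
        ((fst (q t) - fst (snd (q t))) * (fst (u t) + snd (u t)) -
         (fst (q t) + fst (snd (q t))) * (fst (u t) - snd (u t))) / 4) (at t within {0..T})"
      using der
    proof eventually_elim
      case (elim t)
      have "((fst (q t) - fst (snd (q t))) * (fst (u t) + snd (u t)) -
         (fst (q t) + fst (snd (q t))) * (fst (u t) - snd (u t))) / 4
         = (fst (q t) * snd (u t) - fst (snd (q t)) * fst (u t)) / 2"
        by (simp add: field_simps)
      then show ?case using elim by (simp only:)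
    qed
  qed (simp_all add: start q0_def)
qed

lemma trajectory_calibrated_curve:
  assumes "trajectory U q0 (sl_Exp (\<psi>, c, t1)) T q u" "U \<subseteq> U_full" "0 < t1"
  shows "calibrated_curve T (\<lambda>t. fst (q t) + fst (snd (q t))) (\<lambda>t. fst (q t) - fst (snd (q t)))
    (\<lambda>t. snd (snd (q t))) (\<lambda>t. fst (u t) + snd (u t)) (\<lambda>t. fst (u t) - snd (u t)) \<psi> c t1"
proof -
  have "q T = sl_Exp (\<psi>, c, t1)" using assms(1) by (simp add: trajectory_def)
  then show ?thesis
    using trajectory_causal_curve[OF assms(1,2)] \<open>0 < t1\<close>
    by (intro calibrated_curve.intro calibrated_curve_axioms.intro) (auto simp: sl_Exp_geo field_simps)
qed

lemma sl_length_light_cone: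
  "sl_length T u = (LINT t|lebesgue_on {0..T}. sqrt ((fst (u t) + snd (u t)) * (fst (u t) - snd (u t))))"
  by (simp add: sl_length_def power2_eq_square algebra_simps)

lemma sl_length_le:
  assumes "trajectory U q0 (sl_Exp (\<psi>, c, t1)) T q u" "U \<subseteq> U_full" "0 < t1"
  shows "sl_length T u \<le> t1"
  using calibrated_curve.length_le[OF trajectory_calibrated_curve[OF assms]]
  by (simp add: sl_length_light_cone)

lemma sl_length_eq_imp_reparametrization:
  assumes tr: "trajectory U q0 (sl_Exp (\<psi>, c, t1)) T q u" "U \<subseteq> U_full" "0 < t1"
    and eq: "sl_length T u = t1"
  shows "reparametrization T q t1 (\<lambda>t. sl_Exp (\<psi>, c, t))"
proof -
  interpret calibrated_curve T "\<lambda>t. fst (q t) + fst (snd (q t))" "\<lambda>t. fst (q t) - fst (snd (q t))"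
    "\<lambda>t. snd (snd (q t))" "\<lambda>t. fst (u t) + snd (u t)" "\<lambda>t. fst (u t) - snd (u t)" \<psi> c t1
    by (rule trajectory_calibrated_curve[OF tr])
  have "q t = sl_Exp (\<psi>, c, \<sigma> t)" if t: "t \<in> {0..T}" for t
    using geo_v_\<sigma>[OF t] length_eq_imp_geodesic[OF _ t] eq
    by (simp add: sl_length_light_cone sl_Exp_geo prod_eq_iff)
  then show ?thesis
    unfolding reparametrization_def using mono_\<sigma> lip_\<sigma> \<sigma>_image by blast
qed

section \<open>Geodesics and their reparametrizations as trajectories\<close>

lemma sl_Exp_has_vector_derivative:
  "((\<lambda>s. sl_Exp (\<psi>, c, s)) has_vector_derivative
     (cosh (\<psi> + c * s) *\<^sub>R X1 (sl_Exp (\<psi>, c, s)) + sinh (\<psi> + c * s) *\<^sub>R X2 (sl_Exp (\<psi>, c, s))))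
   (at s within S)"
proof -
  let ?V = "geo_v \<psi> c s" and ?W = "geo_v (- \<psi>) (- c) s" and ?\<theta> = "\<psi> + c * s"
  have eq: "cosh ?\<theta> *\<^sub>R X1 (sl_Exp (\<psi>, c, s)) + sinh ?\<theta> *\<^sub>R X2 (sl_Exp (\<psi>, c, s))
      = ((exp ?\<theta> + exp (- \<psi> + - c * s)) / 2, (exp ?\<theta> - exp (- \<psi> + - c * s)) / 2,
         (?W * exp ?\<theta> - ?V * exp (- \<psi> - c * s)) / 4)"
    by (simp add: X1_def X2_def sl_Exp_geo cosh_def sinh_def field_simps)
  show ?thesis
    unfolding eq unfolding sl_Exp_geo
    by (intro has_vector_derivative_Pair)
      (auto simp flip: has_real_derivative_iff_has_vector_derivative
        intro!: DERIV_cdivide DERIV_add DERIV_diff geo_v_has_real_derivative geo_z_has_real_derivative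
          geo_v_has_real_derivative[of "- \<psi>" "- c", simplified])
qed

lemma continuous_on_sl_Exp: "continuous_on S (\<lambda>s. sl_Exp (\<psi>, c, s))"
  by (rule continuous_on_vector_derivative) (rule sl_Exp_has_vector_derivative)

lemma sl_Exp_lipschitz: "\<exists>L. L-lipschitz_on {0..r} (\<lambda>s. sl_Exp (\<psi>, c, s))"
  by (rule continuous_vector_derivative_imp_lipschitz[OF sl_Exp_has_vector_derivative])
    (auto simp: X1_def X2_def split_beta intro!: continuous_intros continuous_on_sl_Exp)

lemma sl_Exp_0: "sl_Exp (\<psi>, c, 0) = q0"
  by (simp add: sl_Exp_geo q0_def)

lemma sl_Exp_trajectory:
  assumes "0 < t1"
  shows "trajectory U_red q0 (sl_Exp (\<psi>, c, t1)) t1 (\<lambda>s. sl_Exp (\<psi>, c, s))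
      (\<lambda>s. (cosh (\<psi> + c * s), sinh (\<psi> + c * s)))"
    and "sl_length t1 (\<lambda>s. (cosh (\<psi> + c * s), sinh (\<psi> + c * s))) = t1"
proof -
  have "\<bar>sinh x\<bar> < cosh x" for x :: real
    by (auto simp: abs_less_iff sinh_def cosh_def field_simps)
  moreover have "(\<lambda>s. (cosh (\<psi> + c * s), sinh (\<psi> + c * s))) \<in> borel_measurable (lebesgue_on {0..t1})"
    by (intro continuous_imp_measurable_on_sets_lebesgue continuous_intros) auto
  ultimately show "trajectory U_red q0 (sl_Exp (\<psi>, c, t1)) t1 (\<lambda>s. sl_Exp (\<psi>, c, s))
      (\<lambda>s. (cosh (\<psi> + c * s), sinh (\<psi> + c * s)))"
    unfolding trajectory_def U_red_def
    using assms sl_Exp_0 sl_Exp_lipschitz sl_Exp_has_vector_derivative by auto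
  have "(cosh (\<psi> + c * s))\<^sup>2 - (sinh (\<psi> + c * s))\<^sup>2 = 1" for s
    by (simp add: cosh_square_eq)
  then show "sl_length t1 (\<lambda>s. (cosh (\<psi> + c * s), sinh (\<psi> + c * s))) = t1"
    using assms by (simp add: sl_length_def measure_restrict_space)
qed

text \<open>By the chain rule the control is the geodesic control, of unit speed, multiplied by the
  derivative of the time change. The length is then the integral of that derivative, which is
  \<open>t1\<close> by the fundamental theorem for Lipschitz functions.\<close>

lemma reparametrization_trajectory:
  assumes "0 < t1" and rep: "reparametrization T q t1 (\<lambda>t. sl_Exp (\<psi>, c, t))"
  obtains u where "trajectory U_full q0 (sl_Exp (\<psi>, c, t1)) T q u" "sl_length T u = t1"
proof -
  from rep obtain \<tau> L where mono: "mono_on {0..T} \<tau>" and L: "L-lipschitz_on {0..T} \<tau>"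
    and im: "\<tau> ` {0..T} = {0..t1}" and q: "\<And>s. s \<in> {0..T} \<Longrightarrow> q s = sl_Exp (\<psi>, c, \<tau> s)"
    unfolding reparametrization_def by blast
  \<comment> \<open>Being monotone and onto, \<open>\<tau>\<close> maps endpoints to endpoints; as
    \<open>0 < t1\<close>, this also yields \<open>0 < T\<close>.\<close>
  have "0 \<in> \<tau> ` {0..T}" "t1 \<in> \<tau> ` {0..T}" using im \<open>0 < t1\<close> by auto
  then obtain r s where r: "r \<in> {0..T}" "\<tau> r = 0" and s: "s \<in> {0..T}" "\<tau> s = t1" by auto
  then have "0 \<le> T" by simp
  then have "\<tau> 0 \<in> {0..t1}" "\<tau> T \<in> {0..t1}" using im by auto
  moreover have "\<tau> 0 \<le> \<tau> r" "\<tau> s \<le> \<tau> T"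
    using r(1) s(1) \<open>0 \<le> T\<close> mono_onD[OF mono, of 0 r] mono_onD[OF mono, of s T] by auto
  ultimately have \<tau>: "\<tau> 0 = 0" "\<tau> T = t1" using r s by auto
  then have T: "0 < T" using \<open>0 < t1\<close> \<open>0 \<le> T\<close> by (cases "T = 0") auto
  obtain g where [measurable]: "g \<in> borel_measurable borel" and g_nn: "\<And>t. 0 \<le> g t"
    and g: "AE t in lebesgue_on {0..T}. (\<tau> has_real_derivative g t) (at t within {0..T})"
    using mono_on_lipschitz_differentiable_AE[OF \<open>0 \<le> T\<close> mono L] by blast
  have cont: "continuous_on {0..T} \<tau>" using L lipschitz_on_continuous_on by blast
  \<comment> \<open>Where \<open>g\<close> vanishes the control is 0, which lies in
    \<open>U_full\<close> but not in \<open>U_red\<close>.\<close>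
  define u where "u s = g s *\<^sub>R (cosh (\<psi> + c * \<tau> s), sinh (\<psi> + c * \<tau> s))" for s
  have g_meas: "g \<in> borel_measurable (lebesgue_on {0..T})"
    by (intro measurable_restrict_space1 measurable_completion) simp
  have u_meas: "u \<in> borel_measurable (lebesgue_on {0..T})"
    unfolding u_def[abs_def]
    by (intro borel_measurable_scaleR g_meas continuous_imp_measurable_on_sets_lebesgue
        continuous_intros cont) auto
  have u_in: "u t \<in> U_full" for t
  proof -
    have "\<bar>sinh x\<bar> \<le> cosh x" for x :: real
      by (auto simp: abs_le_iff sinh_def cosh_def field_simps)
    then show ?thesis
      using g_nn by (simp add: u_def U_full_def abs_mult mult_left_mono)
  qed
  have lip_q: "\<exists>M. M-lipschitz_on {0..T} q"
  proof -
    obtain M where M: "M-lipschitz_on {0..t1} (\<lambda>s. sl_Exp (\<psi>, c, s))" using sl_Exp_lipschitz by blast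
    have "(M * L)-lipschitz_on {0..T} (\<lambda>s. sl_Exp (\<psi>, c, \<tau> s))"
      using lipschitz_on_compose2[OF L] M im by auto
    then show ?thesis using q by (metis (no_types, lifting) lipschitz_on_transform)
  qed
  have der_q: "AE t in lebesgue_on {0..T}.
      (q has_vector_derivative (fst (u t) *\<^sub>R X1 (q t) + snd (u t) *\<^sub>R X2 (q t))) (at t within {0..T})"
  proof -
    have "AE t in lebesgue_on {0..T}. t \<in> {0..T}"
      using AE_space[of "lebesgue_on {0..T}"] by (simp add: space_restrict_space)
    then show ?thesis using g
    proof eventually_elim
      case (elim t)
      have "((\<lambda>s. sl_Exp (\<psi>, c, s)) \<circ> \<tau> has_vector_derivative g t *\<^sub>R
          (cosh (\<psi> + c * \<tau> t) *\<^sub>R X1 (sl_Exp (\<psi>, c, \<tau> t)) + sinh (\<psi> + c * \<tau> t) *\<^sub>R X2 (sl_Exp (\<psi>, c, \<tau> t))))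
          (at t within {0..T})"
        using elim(2) by (intro vector_diff_chain_within sl_Exp_has_vector_derivative)
          (simp add: has_real_derivative_iff_has_vector_derivative)
      then have "(q has_vector_derivative g t *\<^sub>R
          (cosh (\<psi> + c * \<tau> t) *\<^sub>R X1 (sl_Exp (\<psi>, c, \<tau> t)) + sinh (\<psi> + c * \<tau> t) *\<^sub>R X2 (sl_Exp (\<psi>, c, \<tau> t))))
          (at t within {0..T})"
        by (rule has_vector_derivative_transform_within[of _ _ _ _ 1]) (use elim(1) q in auto)
      then show ?case using q[OF elim(1)] by (simp add: u_def scaleR_add_right)
    qed
  qed
  have "trajectory U_full q0 (sl_Exp (\<psi>, c, t1)) T q u"
    unfolding trajectory_def
    using T q[of 0] q[of T] \<tau> sl_Exp_0 lip_q u_meas u_in der_q by simp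
  moreover have "sl_length T u = t1"
  proof -
    have "sqrt ((fst (u t))\<^sup>2 - (snd (u t))\<^sup>2) = g t" for t
    proof -
      have "(fst (u t))\<^sup>2 - (snd (u t))\<^sup>2 = (g t)\<^sup>2 * ((cosh (\<psi> + c * \<tau> t))\<^sup>2 - (sinh (\<psi> + c * \<tau> t))\<^sup>2)"
        by (simp add: u_def power_mult_distrib algebra_simps)
      then show ?thesis using g_nn by (simp add: cosh_square_eq)
    qed
    then have "sl_length T u = integral\<^sup>L (lebesgue_on {0..T}) g" by (simp add: sl_length_def)
    moreover have I: "(g has_integral (\<tau> T - \<tau> 0)) {0..T}"
      using g T by (intro lipschitz_fundamental_theorem_AE[OF _ L])
        (auto simp: has_real_derivative_iff_has_vector_derivative)
    moreover have "integrable (lebesgue_on {0..T}) g"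
      using I g_nn by (intro absolutely_integrable_imp_integrable nonnegative_absolutely_integrable_1)
        (auto simp: has_integral_integrable)
    ultimately show ?thesis
      using lebesgue_integral_eq_integral[of "{0..T}" g] \<tau> by (simp add: integral_unique)
  qed
  ultimately show thesis using that by blast
qed

subsection \<open>Surjectivity of the exponential mapping\<close>

text \<open>Near 0 the left side is cubic and the right side quadratic in \<open>s\<close>, while at
  infinity both grow like \<open>exp s / 2\<close> up to the factor \<open>k < 1\<close>. The
  difference \<open>h\<close> therefore changes sign.\<close>

lemma exists_hyperbolic_ratio:
  fixes k :: real
  assumes "0 < k" "k < 1"
  shows "\<exists>s>0. sinh s - s = k * (cosh s - 1)"
proof -
  define h where "h s = sinh s - s - k * (cosh s - 1)" for s :: real
  have "eventually (\<lambda>s. h s < 0) (at_right 0)"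
    unfolding h_def using assms by real_asymp
  then obtain d where d: "d > 0" "\<And>s. 0 < s \<Longrightarrow> s < d \<Longrightarrow> h s < 0"
    unfolding eventually_at_right_field by auto
  have "eventually (\<lambda>s. h s > 0) at_top"
    unfolding h_def using assms by real_asymp
  then obtain M where M: "\<And>s. s \<ge> M \<Longrightarrow> h s > 0" unfolding eventually_at_top_linorder by auto
  \<comment> \<open>The interval starts at \<open>d / 2\<close> to avoid the trivial root of
    \<open>h\<close> at 0.\<close>
  have "\<exists>s\<ge>d / 2. s \<le> max d M \<and> h s = 0"
  proof (rule IVT')
    show "h (d / 2) \<le> 0" using d by (simp add: less_imp_le)
    show "0 \<le> h (max d M)" using M[of "max d M"] by simp
    show "continuous_on {d / 2..max d M} h" unfolding h_def[abs_def] by (intro continuous_intros)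
  qed (use d in auto)
  then obtain s where "d / 2 \<le> s" "h s = 0" by blast
  then show ?thesis using d(1) by (intro exI[of _ s]) (auto simp: h_def)
qed

text \<open>For \<open>c\<close> nonzero and \<open>s = c t\<close>, the ratio
  \<open>4 z / (v w)\<close> equals \<open>(sinh s - s) / (cosh s - 1)\<close> and so determines
  \<open>s\<close> alone. Then \<open>v w = 2 (cosh s - 1) / c\<^sup>2\<close> gives
  \<open>c\<close> up to sign, and \<open>v\<close> gives \<open>\<psi>\<close>.\<close>

lemma sl_Exp_surj:
  fixes v w z :: real
  assumes v: "0 < v" and w: "0 < w" and z: "4 * \<bar>z\<bar> < v * w"
  shows "\<exists>\<psi> c t. 0 < t \<and> sl_Exp (\<psi>, c, t) = ((v + w) / 2, (v - w) / 2, z)"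
proof (cases "z = 0")
  case True
  \<comment> \<open>For \<open>c = 0\<close> the equations are \<open>v = t * exp \<psi>\<close> and
    \<open>w = t * exp (- \<psi>)\<close>.\<close>
  define t \<psi> where "t = sqrt (v * w)" and "\<psi> = ln (v / t)"
  have t: "t > 0" "t * t = v * w" using v w by (auto simp: t_def)
  have "exp \<psi> = v / t" using v t by (simp add: \<psi>_def)
  moreover have "t * t / v = w" using t(2) v by simp
  ultimately have "geo_v \<psi> 0 t = v" "geo_v (- \<psi>) 0 t = w" "geo_z 0 t = z"
    using t True by (auto simp: geo_v_def geo_z_def exp_minus field_simps)
  then show ?thesis using t by (intro exI[of _ \<psi>] exI[of _ 0] exI[of _ t]) (simp add: sl_Exp_geo)
next
  case False
  define k where "k = 4 * \<bar>z\<bar> / (v * w)"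
  have vw: "v * w > 0" using v w by simp
  have "0 < k" "k < 1" using False z vw by (auto simp: k_def)
  then obtain r where r: "r > 0" "sinh r - r = k * (cosh r - 1)" using exists_hyperbolic_ratio by blast
  \<comment> \<open>As \<open>sinh s - s\<close> is odd and \<open>cosh s - 1\<close> even, the sign
    of \<open>z\<close> passes to \<open>s\<close>. Giving \<open>c\<close> the same sign makes
    \<open>t = s / c\<close> positive.\<close>
  define s where "s = sgn z * r"
  have s: "sinh s - s = 4 * z / (v * w) * (cosh s - 1)" "s \<noteq> 0" "sgn s = sgn z"
    using r False by (auto simp: s_def k_def sgn_if)
  have "cosh s \<noteq> 1" using s(2) by simp
  then have cosh: "cosh s > 1" using cosh_real_ge_1[of s] by linarith
  define C where "C = cosh s - 1"
  have C: "C > 0" using cosh by (simp add: C_def)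
  define R where "R = sqrt (2 * (cosh s - 1) / (v * w))"
  define c where "c = sgn z * R"
  have R: "R > 0" "R\<^sup>2 = 2 * (cosh s - 1) / (v * w)"
    using cosh vw by (simp_all add: R_def)
  have c2: "c\<^sup>2 = 2 * (cosh s - 1) / (v * w)"
    using R(2) False by (simp add: c_def power_mult_distrib sgn_if)
  have c0: "c \<noteq> 0" "sgn c = sgn z" using R(1) False by (auto simp: c_def sgn_mult sgn_if)
  define t where "t = s / c"
  have t: "t > 0" "c * t = s"
    using s c0 False by (auto simp: t_def sgn_if zero_less_divide_iff split: if_splits)
  have pos: "c * v / (exp s - 1) > 0"
    using s c0 False v by (auto simp: sgn_if zero_less_divide_iff mult_less_0_iff zero_less_mult_iff split: if_splits)
  \<comment> \<open>This solves \<open>v = exp \<psi> * (exp s - 1) / c\<close>; the argument of the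
    logarithm is positive because \<open>c\<close> and \<open>s\<close> have the same sign.\<close>
  define \<psi> where "\<psi> = ln (c * v / (exp s - 1))"
  have \<psi>: "exp \<psi> = c * v / (exp s - 1)" using pos by (simp add: \<psi>_def)
  have es: "exp s - 1 \<noteq> 0" using s(2) by simp
  have "geo_v \<psi> c t = exp \<psi> * (exp s - 1) / c"
    using c0 t by (simp add: geo_v_def exp_add algebra_simps)
  also have "\<dots> = v" using \<psi> es c0 by simp
  finally have V: "geo_v \<psi> c t = v" .
  have "geo_v (- \<psi>) (- c) t = (exp (- \<psi>) * exp (- s) - exp (- \<psi>)) / (- c)"
    using c0 t by (simp add: geo_v_def flip: exp_add)
  also have "\<dots> = (1 - exp (- s)) / (exp \<psi> * c)"
    using c0 by (simp add: exp_minus[of \<psi>] divide_simps)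
  also have "\<dots> = (1 - exp (- s)) * (exp s - 1) / (c\<^sup>2 * v)"
    unfolding \<psi> using es c0 v by (simp add: power2_eq_square ac_simps)
  also have "(1 - exp (- s)) * (exp s - 1) = 2 * (cosh s - 1)"
    by (simp add: cosh_def exp_minus field_simps)
  also have "\<dots> / (c\<^sup>2 * v) = w" unfolding c2 C_def[symmetric] using C v w by (simp add: field_simps)
  finally have W: "geo_v (- \<psi>) (- c) t = w" .
  have "geo_z c t = (sinh s - s) / (2 * c\<^sup>2)" using c0 t by (simp add: geo_z_def)
  also have "\<dots> = z" unfolding s(1) c2 C_def[symmetric] using C v w by (simp add: field_simps)
  finally have Z: "geo_z c t = z" .
  show ?thesis using t V W Z
    by (intro exI[of _ \<psi>] exI[of _ c] exI[of _ t]) (simp add: sl_Exp_geo)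
qed

lemma U_red_subset_U_full: "U_red \<subseteq> U_full"
  by (auto simp: U_red_def U_full_def)

lemma chronological_future_subset: "chronological_future q0 \<subseteq> sl_Exp ` exp_domain"
proof
  fix p assume "p \<in> chronological_future q0"
  then obtain T q u where tr: "trajectory U_red q0 p T q u" by (auto simp: chronological_future_def)
  interpret causal_curve T "\<lambda>t. fst (q t) + fst (snd (q t))" "\<lambda>t. fst (q t) - fst (snd (q t))"
    "\<lambda>t. snd (snd (q t))" "\<lambda>t. fst (u t) + snd (u t)" "\<lambda>t. fst (u t) - snd (u t)"
    by (rule trajectory_causal_curve[OF tr U_red_subset_U_full])
  have "AE t in lebesgue_on {0..T}. u t \<in> U_red"
    using tr by (auto simp: trajectory_def elim: eventually_mono)
  then have "AE t in lebesgue_on {0..T}. 0 < fst (u t) + snd (u t) \<and> 0 < fst (u t) - snd (u t)"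
    by eventually_elim (auto simp: U_red_def split_beta)
  from sl_Exp_surj[OF timelike_end[OF this]] obtain \<psi> c t
    where t: "0 < t" and E: "sl_Exp (\<psi>, c, t) = q T" by auto
  have "q T = p" using tr by (simp add: trajectory_def)
  with t E show "p \<in> sl_Exp ` exp_domain"
    by (intro image_eqI[of _ _ "(\<psi>, c, t)"]) (auto simp: exp_domain_def)
qed

subsection \<open>Maximal lengths\<close>

lemma trajectory_U_red_imp_U_full: "trajectory U_red a b T q u \<Longrightarrow> trajectory U_full a b T q u"
  using U_red_subset_U_full unfolding trajectory_def by (auto elim: eventually_mono)

text \<open>The geodesic is admissible for every such \<open>U\<close> and attains the calibration
  bound. Taking \<open>U\<close> to be \<open>U_full\<close> and \<open>U_red\<close> gives the
  equality of the two distances.\<close>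

lemma max_length_sl_Exp:
  assumes "0 < t1" and U: "U_red \<subseteq> U" "U \<subseteq> U_full"
  shows "max_length U q0 (sl_Exp (\<psi>, c, t1)) = ereal t1"
  unfolding max_length_def
proof (rule cSup_eq_maximum)
  have "trajectory U q0 (sl_Exp (\<psi>, c, t1)) t1 (\<lambda>s. sl_Exp (\<psi>, c, s))
      (\<lambda>s. (cosh (\<psi> + c * s), sinh (\<psi> + c * s)))"
    using sl_Exp_trajectory(1)[OF assms(1), of \<psi> c] U(1)
    unfolding trajectory_def by (auto elim!: eventually_mono)
  then show "ereal t1 \<in> {ereal (sl_length T u) |T q u. trajectory U q0 (sl_Exp (\<psi>, c, t1)) T q u}"
    using sl_Exp_trajectory(2)[OF assms(1), of \<psi> c] by (auto intro!: exI)
  show "x \<le> ereal t1"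
    if "x \<in> {ereal (sl_length T u) |T q u. trajectory U q0 (sl_Exp (\<psi>, c, t1)) T q u}" for x
    using that sl_length_le[OF _ U(2) assms(1)] by auto
qed

theorem theorem7:
  fixes q1 :: heis and \<psi> c t1 :: real
  assumes "q1 \<in> chronological_future q0"
    and "(\<psi>, c, t1) = inv_into exp_domain sl_Exp q1"
  shows "length_maximizer U_red q0 q1 t1 (\<lambda>t. sl_Exp (\<psi>, c, t)) \<and>
    (\<forall>T q. length_maximizer U_full q0 q1 T q \<longleftrightarrow>
       reparametrization T q t1 (\<lambda>t. sl_Exp (\<psi>, c, t))) \<and>
    (\<forall>p \<in> chronological_future q0. d_full p = d_red p)"
proof (intro conjI allI ballI)
  \<comment> \<open>Membership in the image ensures that \<open>inv_into\<close> returns a genuine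
    preimage in \<open>exp_domain\<close>, hence \<open>0 < t1\<close>.\<close>
  have "q1 \<in> sl_Exp ` exp_domain" using assms(1) chronological_future_subset by blast
  then have q1: "q1 = sl_Exp (\<psi>, c, t1)" and "(\<psi>, c, t1) \<in> exp_domain"
    unfolding assms(2) by (simp_all add: f_inv_into_f inv_into_into)
  then have t1: "0 < t1" by (simp add: exp_domain_def)
  note tr = sl_Exp_trajectory(1)[OF t1, of \<psi> c] and len = sl_Exp_trajectory(2)[OF t1, of \<psi> c]
  show "length_maximizer U_red q0 q1 t1 (\<lambda>t. sl_Exp (\<psi>, c, t))"
    unfolding length_maximizer_def q1
    using tr len sl_length_le[OF _ U_red_subset_U_full t1] by metis
  fix T q
  show "length_maximizer U_full q0 q1 T q \<longleftrightarrow> reparametrization T q t1 (\<lambda>t. sl_Exp (\<psi>, c, t))"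
  proof
    assume "length_maximizer U_full q0 q1 T q"
    then obtain u where u: "trajectory U_full q0 q1 T q u"
      and max: "\<And>T' q' u'. trajectory U_full q0 q1 T' q' u' \<Longrightarrow> sl_length T' u' \<le> sl_length T u"
      unfolding length_maximizer_def by blast
    \<comment> \<open>The geodesic competes in the full problem with length \<open>t1\<close>; the
      calibration gives the opposite inequality, so the maximizer is in the equality case.\<close>
    have "t1 \<le> sl_length T u"
      using max[unfolded q1, OF trajectory_U_red_imp_U_full[OF tr]] len by simp
    then have "sl_length T u = t1"
      using sl_length_le[OF u[unfolded q1] order_refl t1] by simp
    then show "reparametrization T q t1 (\<lambda>t. sl_Exp (\<psi>, c, t))"
      by (rule sl_length_eq_imp_reparametrization[OF u[unfolded q1] order_refl t1])
  next
    assume "reparametrization T q t1 (\<lambda>t. sl_Exp (\<psi>, c, t))"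
    then obtain u where "trajectory U_full q0 q1 T q u" "sl_length T u = t1"
      using reparametrization_trajectory[OF t1] q1 by metis
    then show "length_maximizer U_full q0 q1 T q"
      unfolding length_maximizer_def using sl_length_le[OF _ order_refl t1] q1 by metis
  qed
next
  fix p assume "p \<in> chronological_future q0"
  then obtain \<psi> c t where "p = sl_Exp (\<psi>, c, t)" "0 < t"
    using chronological_future_subset by (auto simp: exp_domain_def)
  then show "d_full p = d_red p"
    using max_length_sl_Exp[OF _ U_red_subset_U_full order_refl]
      max_length_sl_Exp[OF _ order_refl U_red_subset_U_full]
    by (simp add: d_full_def d_red_def)
qed

end
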